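(* Let $\mathcal X$ be a space of homogeneous type with degree $(\alpha_0,n_0,N_0)$, let $\varphi$ be a growth function on $\mathcal X\times[0,\infty)$, and let $\{A_t\}_{t>0}$ satisfy Assumption SP. Let $x_0\in\mathcal X$ and $$\delta>n_0+N_0+\frac1m\left[\frac{n_0p(\varphi)}{i(\varphi)}-\alpha_0\right]-\frac{n_0[r(\varphi)-1]}{r(\varphi)}.$$ Then there exists a positive constant $C_{(\delta)}$, depending on $\delta$, such that, for all $f\in\mathrm{BMO}^\varphi_A(\mathcal X)$ (and all $t\in(0,\infty)$), $$\int_{\mathcal X}\frac{|f(x)-A_tf(x)|}{[t^{1/m}+d(x_0,x)]^{\delta}\,\|\chi_{B(x_0,t^{1/m}+d(x_0,x))}\|_{L^\varphi(\mathcal X)}}\,d\mu(x)\le\frac{C_{(\delta)}}{t^{\delta/m}}\,\|f\|_{\mathrm{BMO}^\varphi_A(\mathcal X)}.$$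
   Context: **Spaces of homogeneous type.** $(\mathcal X,d,\mu)$: $d:\mathcal X\times\mathcal X\to[0,\infty)$ is a quasi-metric ($d(x,y)=0$ iff $x=y$; $d(x,y)=d(y,x)$; $d(x,y)\le C_1[d(x,z)+d(z,y)]$ for a constant $C_1\in[1,\infty)$), and $\mu$ is a nonnegative Borel measure for which there is $C_2\in[1,\infty)$ with $\mu(B(x,2r))\le C_2\mu(B(x,r))<\infty$ for all balls $B(x,r)=\{y: d(y,x)<r\}$ (balls have positive measure). Consider the conditions: ($D_n$), $n\in(0,\infty)$: $\exists C$ with $\mu(B(x,\lambda r))\le C\lambda^n\mu(B(x,r))$ for all $x\in\mathcal X$, $r>0$, $\lambda\ge1$; ($E_N$), $N\in[0,\infty)$: $\exists C$ with $\mu(B(y,r))\le C[1+d(x,y)/r]^N\mu(B(x,r))$ for all $x,y\in\mathcal X$, $r>0$; ($R_\alpha$), $\alpha\in[0,n]$ with $n$ as in ($D_n$): $\exists C\ge1$ with $C^{-1}\lambda^\alpha\mu(B(x,r))\le\mu(B(x,\lambda r))$ for all $x\in\mathcal X$, $r\in(0,2\,\mathrm{diam}(\mathcal X))$, $\lambda\in[1,2\,\mathrm{diam}(\mathcal X)/r)$. Set $n_0=\inf\{n:(D_n)\}$, $N_0=\inf\{N:(E_N)\}$, $\alpha_0=\sup\{\alpha:(R_\alpha)\}$; $(\alpha_0,n_0,N_0)$ is the degree of $\mathcal X$. **Growth functions.** $\varphi:\mathcal X\times[0,\infty)\to[0,\infty)$ is of uniformly upper type $p$ (resp. uniformly lower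 type $p$) if $\exists C$ with $\varphi(x,st)\le Cs^p\varphi(x,t)$ for all $x\in\mathcal X$, $t\ge0$ and $s\ge1$ (resp. $s\in(0,1)$). For $p\in(1,\infty)$, $\varphi\in\mathbb A_p(\mathcal X)$ means $\sup_{t>0}\sup_{B}\frac1{\mu(B)}\int_B\varphi(x,t)\,d\mu(x)\{\frac1{\mu(B)}\int_B[\varphi(x,t)]^{-1/(p-1)}d\mu(x)\}^{p-1}<\infty$; $\varphi\in\mathbb A_1(\mathcal X)$ means $\sup_{t>0}\sup_B\frac1{\mu(B)}\int_B\varphi(x,t)d\mu(x)\,\{\mathrm{ess\,sup}_{y\in B}[\varphi(y,t)]^{-1}\}<\infty$; $\mathbb A_\infty=\bigcup_{p\in[1,\infty)}\mathbb A_p$. For $q\in(1,\infty)$, $\varphi\in\mathbb{RH}_q(\mathcal X)$ means $\sup_{t>0}\sup_B\{\frac1{\mu(B)}\int_B[\varphi(x,t)]^qd\mu(x)\}^{1/q}\{\frac1{\mu(B)}\int_B\varphi(x,t)d\mu(x)\}^{-1}<\infty$; for $q=\infty$ the first factor is replaced by $\mathrm{ess\,sup}_{y\in B}\varphi(y,t)$. (Suprema over all balls $B$.) $\varphi$ is a growth function if: for each $x$, $\varphi(x,\cdot)$ is an Orlicz function (nondecreasing, $\varphi(x,0)=0$, $\varphi(x,t)>0$ for $t>0$, $\lim_{t\to\infty}\varphi(x,t)=\infty$; not necessarily convex); $\varphi(\cdot,t)$ is measurable for each $t$; $\varphi\in\mathbb A_\infty(\mathcal X)$; and $\varphi$ is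 of uniformly upper type $1$ and of uniformly lower type $p$ for some $p\in(0,1]$. Indices: $i(\varphi)=\sup\{p\in(0,\infty):\varphi$ is of uniformly lower type $p\}$, $p(\varphi)=\inf\{p\in[1,\infty):\varphi\in\mathbb A_p(\mathcal X)\}$, $r(\varphi)=\sup\{q\in(1,\infty]:\varphi\in\mathbb{RH}_q(\mathcal X)\}$, with $(r-1)/r:=1$ if $r=\infty$. $\|f\|_{L^\varphi(\mathcal X)}=\inf\{\lambda>0:\int_{\mathcal X}\varphi(x,|f(x)|/\lambda)\,d\mu(x)\le1\}$; $\chi_B$ is the characteristic function of $B$. **Generalized approximation to the identity.** Fix $M>n_0[1+p(\varphi)/i(\varphi)]-\alpha_0$, a constant $m>0$, and a positive, bounded, decreasing function $g$ on $[0,\infty)$ with $\lim_{r\to\infty}r^Mg(r^m)=0$. The operators are $A_tf(x)=\int_{\mathcal X}a_t(x,y)f(y)\,d\mu(y)$, $t>0$, with $|a_t(x,y)|\le h_t(x,y):=\frac1{\mu(B(x,t^{1/m}))}g\big(\frac{[d(x,y)]^m}{t}\big)$ for all $x,y\in\mathcal X$. They act on $f\in\mathcal M(\mathcal X):=\bigcup_{x_0\in\mathcal X}\bigcup_\beta\mathcal M_{(x_0,\beta)}(\mathcal X)$, the union over $0<\beta<M-n_0[1+p(\varphi)/i(\varphi)]+\alpha_0$, where $\mathcal M_{(x_0,\beta)}(\mathcal X)$ is the set of $f\in L^1_{\rm loc}(\mathcal X)$ with $\int_{\mathcal X}\frac{|f(x)|}{[1+d(x_0,x)]^{n_0p(\varphi)/i(\varphi)-\alpha_0+\beta}\,\mu(B(x_0,1+d(x_0,x)))}\,d\mu(x)<\infty$.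 **Assumption SP.** $\{A_t\}_{t>0}$ is a generalized approximation to the identity, that is, $A_tf(x)=\int_{\mathcal X}a_t(x,y)f(y)\,d\mu(y)$ with $|a_t(x,y)|\le\frac1{\mu(B(x,t^{1/m}))}g\big(\frac{[d(x,y)]^m}{t}\big)$ for all $t>0$ and $x,y\in\mathcal X$, where $g$ is positive, bounded, decreasing and $\lim_{r\to\infty}r^Mg(r^m)=0$; $A_0:=I$ (identity), and $A_tA_sf=A_{t+s}f$ almost everywhere for all $s,t\in[0,\infty)$ and $f\in\mathcal M(\mathcal X)$. **Space.** $\mathrm{BMO}^\varphi_A(\mathcal X)$ is the set of $f\in\mathcal M(\mathcal X)$ with $\|f\|_{\mathrm{BMO}^\varphi_A(\mathcal X)}=\sup_B\frac1{\|\chi_B\|_{L^\varphi(\mathcal X)}}\int_B|f(x)-A_{t_B}f(x)|\,d\mu(x)<\infty$, the supremum over all balls $B$, with $t_B:=r_B^m$, $r_B$ the radius of $B$. *)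

theory Defs
  imports "HOL-Probability.Essential_Supremum"
begin

section \<open>Spaces of homogeneous type\<close>

definition quasi_metric :: "('a \<Rightarrow> 'a \<Rightarrow> real) \<Rightarrow> bool" where
  "quasi_metric d \<longleftrightarrow>
     (\<forall>x y. 0 \<le> d x y) \<and> (\<forall>x y. d x y = 0 \<longleftrightarrow> x = y) \<and> (\<forall>x y. d x y = d y x) \<and>
     (\<exists>C1\<ge>1. \<forall>x y z. d x y \<le> C1 * (d x z + d z y))"

definition qball :: "('a \<Rightarrow> 'a \<Rightarrow> real) \<Rightarrow> 'a \<Rightarrow> real \<Rightarrow> 'a set" where
  "qball d x r = {y. d y x < r}"

definition qopen :: "('a \<Rightarrow> 'a \<Rightarrow> real) \<Rightarrow> 'a set \<Rightarrow> bool" where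
  "qopen d U \<longleftrightarrow> (\<forall>x\<in>U. \<exists>r>0. qball d x r \<subseteq> U)"

definition qdiam :: "('a \<Rightarrow> 'a \<Rightarrow> real) \<Rightarrow> ereal" where
  "qdiam d = (SUP x. SUP y. ereal (d x y))"

text \<open>The underlying set is the whole type. For a general quasi-metric the balls need not be
  Borel sets, so their measurability, without which the doubling condition has no
  meaning, is stated separately.\<close>

definition homogeneous_type :: "('a \<Rightarrow> 'a \<Rightarrow> real) \<Rightarrow> 'a measure \<Rightarrow> bool" where
  "homogeneous_type d \<mu> \<longleftrightarrow>
     quasi_metric d \<and>
     space \<mu> = UNIV \<and> sets \<mu> = sigma_sets UNIV {U. qopen d U} \<and>
     (\<forall>x. \<forall>r>0. qball d x r \<in> sets \<mu> \<and>
        0 < emeasure \<mu> (qball d x r) \<and> emeasure \<mu> (qball d x r) < \<infinity>) \<and>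
     (\<exists>C2\<ge>1. \<forall>x. \<forall>r>0.
        measure \<mu> (qball d x (2 * r)) \<le> C2 * measure \<mu> (qball d x r))"

definition cond_D :: "('a \<Rightarrow> 'a \<Rightarrow> real) \<Rightarrow> 'a measure \<Rightarrow> real \<Rightarrow> bool" where
  "cond_D d \<mu> n \<longleftrightarrow> 0 < n \<and>
     (\<exists>C. \<forall>x. \<forall>r>0. \<forall>l\<ge>1.
        measure \<mu> (qball d x (l * r)) \<le> C * l powr n * measure \<mu> (qball d x r))"

definition cond_E :: "('a \<Rightarrow> 'a \<Rightarrow> real) \<Rightarrow> 'a measure \<Rightarrow> real \<Rightarrow> bool" where
  "cond_E d \<mu> N \<longleftrightarrow> 0 \<le> N \<and>
     (\<exists>C. \<forall>x y. \<forall>r>0.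
        measure \<mu> (qball d y r) \<le> C * (1 + d x y / r) powr N * measure \<mu> (qball d x r))"

text \<open>The range of \<open>\<alpha>\<close> is \<open>[0, n]\<close> for every \<open>n\<close> admissible in \<open>cond_D\<close>. If the space has at
  least two points the inequality itself already forces this; the clause only matters for a
  one-point space, where the inequality is vacuous and \<open>\<alpha>\<close> would otherwise be unbounded.\<close>

definition cond_R :: "('a \<Rightarrow> 'a \<Rightarrow> real) \<Rightarrow> 'a measure \<Rightarrow> real \<Rightarrow> bool" where
  "cond_R d \<mu> \<alpha> \<longleftrightarrow> 0 \<le> \<alpha> \<and> (\<forall>n. cond_D d \<mu> n \<longrightarrow> \<alpha> \<le> n) \<and>
     (\<exists>C\<ge>1. \<forall>x r l. 0 < r \<and> ereal r < 2 * qdiam d \<and> 1 \<le> l \<and> ereal l < 2 * qdiam d / ereal r \<longrightarrow>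
        inverse C * l powr \<alpha> * measure \<mu> (qball d x r) \<le> measure \<mu> (qball d x (l * r)))"

definition deg_n :: "('a \<Rightarrow> 'a \<Rightarrow> real) \<Rightarrow> 'a measure \<Rightarrow> real" where
  "deg_n d \<mu> = Inf {n. cond_D d \<mu> n}"

definition deg_N :: "('a \<Rightarrow> 'a \<Rightarrow> real) \<Rightarrow> 'a measure \<Rightarrow> real" where
  "deg_N d \<mu> = Inf {N. cond_E d \<mu> N}"

definition deg_alpha :: "('a \<Rightarrow> 'a \<Rightarrow> real) \<Rightarrow> 'a measure \<Rightarrow> real" where
  "deg_alpha d \<mu> = Sup {\<alpha>. cond_R d \<mu> \<alpha>}"

section \<open>Growth functions\<close>

text \<open>A function \<open>\<X> \<times> [0,\<infinity>) \<rightarrow> [0,\<infinity>)\<close> is a term \<open>\<phi> :: 'a \<Rightarrow> real \<Rightarrow> real\<close> whose values at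
  negative second argument are never used.\<close>

definition upper_type :: "('a \<Rightarrow> real \<Rightarrow> real) \<Rightarrow> real \<Rightarrow> bool" where
  "upper_type \<phi> p \<longleftrightarrow> (\<exists>C. \<forall>x. \<forall>t\<ge>0. \<forall>s\<ge>1. \<phi> x (s * t) \<le> C * s powr p * \<phi> x t)"

definition lower_type :: "('a \<Rightarrow> real \<Rightarrow> real) \<Rightarrow> real \<Rightarrow> bool" where
  "lower_type \<phi> p \<longleftrightarrow>
     (\<exists>C. \<forall>x. \<forall>t\<ge>0. \<forall>s. 0 < s \<and> s < 1 \<longrightarrow> \<phi> x (s * t) \<le> C * s powr p * \<phi> x t)"

definition orlicz :: "(real \<Rightarrow> real) \<Rightarrow> bool" where
  "orlicz \<Phi> \<longleftrightarrow> mono_on {0..} \<Phi> \<and> \<Phi> 0 = 0 \<and> (\<forall>t>0. 0 < \<Phi> t) \<and> filterlim \<Phi> at_top at_top"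

text \<open>Powers of extended nonnegative numbers; only used with \<open>a > 0\<close>.\<close>

definition ennpowr :: "ennreal \<Rightarrow> real \<Rightarrow> ennreal" where
  "ennpowr x a = (if x = \<infinity> then \<infinity> else ennreal (enn2real x powr a))"

definition avg :: "'a measure \<Rightarrow> 'a set \<Rightarrow> ('a \<Rightarrow> ennreal) \<Rightarrow> ennreal" where
  "avg \<mu> B h = (\<integral>\<^sup>+x\<in>B. h x \<partial>\<mu>) / emeasure \<mu> B"

definition sup_balls :: "('a \<Rightarrow> 'a \<Rightarrow> real) \<Rightarrow> ('a set \<Rightarrow> ennreal) \<Rightarrow> ennreal" where
  "sup_balls d F = (SUP x. SUP r\<in>{0<..}. F (qball d x r))"

definition A_class ::
  "('a \<Rightarrow> 'a \<Rightarrow> real) \<Rightarrow> 'a measure \<Rightarrow> real \<Rightarrow> ('a \<Rightarrow> real \<Rightarrow> real) \<Rightarrow> bool" where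
  "A_class d \<mu> p \<phi> \<longleftrightarrow> 1 \<le> p \<and>
     (SUP t\<in>{0<..}. sup_balls d (\<lambda>B.
        avg \<mu> B (\<lambda>x. ennreal (\<phi> x t)) *
        (if p = 1 then esssup (restrict_space \<mu> B) (\<lambda>y. inverse (ennreal (\<phi> y t)))
         else ennpowr (avg \<mu> B (\<lambda>x. ennreal (\<phi> x t powr (- 1 / (p - 1))))) (p - 1)))) < \<infinity>"

definition RH_class ::
  "('a \<Rightarrow> 'a \<Rightarrow> real) \<Rightarrow> 'a measure \<Rightarrow> ereal \<Rightarrow> ('a \<Rightarrow> real \<Rightarrow> real) \<Rightarrow> bool" where
  "RH_class d \<mu> q \<phi> \<longleftrightarrow> 1 < q \<and>
     (SUP t\<in>{0<..}. sup_balls d (\<lambda>B.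
        (if q = \<infinity> then esssup (restrict_space \<mu> B) (\<lambda>y. ennreal (\<phi> y t))
         else ennpowr (avg \<mu> B (\<lambda>x. ennreal (\<phi> x t powr real_of_ereal q))) (1 / real_of_ereal q)) *
        inverse (avg \<mu> B (\<lambda>x. ennreal (\<phi> x t))))) < \<infinity>"

definition growth_function ::
  "('a \<Rightarrow> 'a \<Rightarrow> real) \<Rightarrow> 'a measure \<Rightarrow> ('a \<Rightarrow> real \<Rightarrow> real) \<Rightarrow> bool" where
  "growth_function d \<mu> \<phi> \<longleftrightarrow>
     (\<forall>x. orlicz (\<phi> x)) \<and>
     (\<forall>t\<ge>0. (\<lambda>x. \<phi> x t) \<in> borel_measurable \<mu>) \<and>
     (\<exists>p\<ge>1. A_class d \<mu> p \<phi>) \<and>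
     upper_type \<phi> 1 \<and> (\<exists>p. 0 < p \<and> p \<le> 1 \<and> lower_type \<phi> p)"

definition index_i :: "('a \<Rightarrow> real \<Rightarrow> real) \<Rightarrow> real" where
  "index_i \<phi> = Sup {p. 0 < p \<and> lower_type \<phi> p}"

definition index_p :: "('a \<Rightarrow> 'a \<Rightarrow> real) \<Rightarrow> 'a measure \<Rightarrow> ('a \<Rightarrow> real \<Rightarrow> real) \<Rightarrow> real" where
  "index_p d \<mu> \<phi> = Inf {p. 1 \<le> p \<and> A_class d \<mu> p \<phi>}"

definition index_r :: "('a \<Rightarrow> 'a \<Rightarrow> real) \<Rightarrow> 'a measure \<Rightarrow> ('a \<Rightarrow> real \<Rightarrow> real) \<Rightarrow> ereal" where
  "index_r d \<mu> \<phi> = Sup {q. 1 < q \<and> RH_class d \<mu> q \<phi>}"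

text \<open>The quotient \<open>(r - 1) / r\<close>, read as \<open>1\<close> for \<open>r = \<infinity>\<close>.\<close>

definition conj_quot :: "ereal \<Rightarrow> real" where
  "conj_quot r = (if r = \<infinity> then 1 else (real_of_ereal r - 1) / real_of_ereal r)"

definition Lphi_norm :: "'a measure \<Rightarrow> ('a \<Rightarrow> real \<Rightarrow> real) \<Rightarrow> ('a \<Rightarrow> real) \<Rightarrow> ennreal" where
  "Lphi_norm \<mu> \<phi> f =
     Inf {ennreal l | l. 0 < l \<and> (\<integral>\<^sup>+x. ennreal (\<phi> x (\<bar>f x\<bar> / l)) \<partial>\<mu>) \<le> 1}"

section \<open>Generalized approximations to the identity and the associated BMO space\<close>

definition L1_loc :: "('a \<Rightarrow> 'a \<Rightarrow> real) \<Rightarrow> 'a measure \<Rightarrow> ('a \<Rightarrow> complex) set" where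
  "L1_loc d \<mu> = {f. f \<in> borel_measurable \<mu> \<and> (\<forall>x. \<forall>r>0. set_integrable \<mu> (qball d x r) f)}"

definition M_at :: "('a \<Rightarrow> 'a \<Rightarrow> real) \<Rightarrow> 'a measure \<Rightarrow> ('a \<Rightarrow> real \<Rightarrow> real) \<Rightarrow>
    'a \<Rightarrow> real \<Rightarrow> ('a \<Rightarrow> complex) set" where
  "M_at d \<mu> \<phi> x0 \<beta> = {f \<in> L1_loc d \<mu>.
     (\<integral>\<^sup>+x. ennreal (cmod (f x) /
        ((1 + d x0 x) powr (deg_n d \<mu> * index_p d \<mu> \<phi> / index_i \<phi> - deg_alpha d \<mu> + \<beta>) *
         measure \<mu> (qball d x0 (1 + d x0 x)))) \<partial>\<mu>) < \<infinity>}"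

definition M_space :: "('a \<Rightarrow> 'a \<Rightarrow> real) \<Rightarrow> 'a measure \<Rightarrow> ('a \<Rightarrow> real \<Rightarrow> real) \<Rightarrow>
    real \<Rightarrow> ('a \<Rightarrow> complex) set" where
  "M_space d \<mu> \<phi> M =
     (\<Union>x0. \<Union>\<beta>\<in>{\<beta>. 0 < \<beta> \<and>
         \<beta> < M - deg_n d \<mu> * (1 + index_p d \<mu> \<phi> / index_i \<phi>) + deg_alpha d \<mu>}.
       M_at d \<mu> \<phi> x0 \<beta>)"

definition A_op :: "'a measure \<Rightarrow> (real \<Rightarrow> 'a \<Rightarrow> 'a \<Rightarrow> complex) \<Rightarrow>
    real \<Rightarrow> ('a \<Rightarrow> complex) \<Rightarrow> 'a \<Rightarrow> complex" where
  "A_op \<mu> a t f x = (if t = 0 then f x else (\<integral>y. a t x y * f y \<partial>\<mu>))"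

definition gen_approx_identity :: "('a \<Rightarrow> 'a \<Rightarrow> real) \<Rightarrow> 'a measure \<Rightarrow> real \<Rightarrow> real \<Rightarrow>
    (real \<Rightarrow> real) \<Rightarrow> (real \<Rightarrow> 'a \<Rightarrow> 'a \<Rightarrow> complex) \<Rightarrow> bool" where
  "gen_approx_identity d \<mu> m M g a \<longleftrightarrow>
     (\<forall>s\<ge>0. 0 < g s) \<and> bounded (g ` {0..}) \<and> antimono_on {0..} g \<and>
     ((\<lambda>r. r powr M * g (r powr m)) \<longlongrightarrow> 0) at_top \<and>
     (\<forall>t>0. (\<lambda>(x, y). a t x y) \<in> borel_measurable (\<mu> \<Otimes>\<^sub>M \<mu>)) \<and>
     (\<forall>t>0. \<forall>x y. cmod (a t x y) \<le>
        1 / measure \<mu> (qball d x (t powr (1 / m))) * g (d x y powr m / t))"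

definition assumption_SP :: "('a \<Rightarrow> 'a \<Rightarrow> real) \<Rightarrow> 'a measure \<Rightarrow> ('a \<Rightarrow> real \<Rightarrow> real) \<Rightarrow>
    real \<Rightarrow> real \<Rightarrow> (real \<Rightarrow> real) \<Rightarrow> (real \<Rightarrow> 'a \<Rightarrow> 'a \<Rightarrow> complex) \<Rightarrow> bool" where
  "assumption_SP d \<mu> \<phi> m M g a \<longleftrightarrow>
     gen_approx_identity d \<mu> m M g a \<and>
     (\<forall>s\<ge>0. \<forall>t\<ge>0. \<forall>f\<in>M_space d \<mu> \<phi> M.
        AE x in \<mu>. A_op \<mu> a t (A_op \<mu> a s f) x = A_op \<mu> a (t + s) f x)"

text \<open>A ball as a set does not determine its radius, so the supremum runs over centres and radii.\<close>

definition BMO_norm :: "('a \<Rightarrow> 'a \<Rightarrow> real) \<Rightarrow> 'a measure \<Rightarrow> ('a \<Rightarrow> real \<Rightarrow> real) \<Rightarrow>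
    real \<Rightarrow> (real \<Rightarrow> 'a \<Rightarrow> 'a \<Rightarrow> complex) \<Rightarrow> ('a \<Rightarrow> complex) \<Rightarrow> ennreal" where
  "BMO_norm d \<mu> \<phi> m a f =
     (SUP z. SUP r\<in>{0<..}.
        (\<integral>\<^sup>+x\<in>qball d z r. ennreal (cmod (f x - A_op \<mu> a (r powr m) f x)) \<partial>\<mu>) /
        Lphi_norm \<mu> \<phi> (indicator (qball d z r)))"

definition BMO :: "('a \<Rightarrow> 'a \<Rightarrow> real) \<Rightarrow> 'a measure \<Rightarrow> ('a \<Rightarrow> real \<Rightarrow> real) \<Rightarrow>
    real \<Rightarrow> real \<Rightarrow> (real \<Rightarrow> 'a \<Rightarrow> 'a \<Rightarrow> complex) \<Rightarrow> ('a \<Rightarrow> complex) set" where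
  "BMO d \<mu> \<phi> m M a = {f \<in> M_space d \<mu> \<phi> M. BMO_norm d \<mu> \<phi> m a f < \<infinity>}"

end

theory Submission
  imports Defs
begin

text \<open>Put \<open>r = t powr (1 / m)\<close> and split the space into the dyadic annuli
  \<open>2 ^ k * r \<le> r + d x0 x < 2 ^ Suc k * r\<close>. The ball \<open>B\<close> of radius \<open>2 ^ Suc k * r\<close> is covered by
  \<open>O(2 powr (k * n))\<close> balls \<open>B\<^sub>i\<close> of radius \<open>r\<close> with bounded total measure relative to \<open>B\<close>, and on each of
  them the BMO norm bounds the integral of \<open>f - A\<^sub>t f\<close> by \<open>\<parallel>\<chi>\<^bsub>B\<^sub>i\<^esub>\<parallel>\<close>. The reverse Hoelder condition
  and the upper type 1 give \<open>\<parallel>\<chi>\<^bsub>B\<^sub>i\<^esub>\<parallel> \<le> C * (\<mu> B\<^sub>i / \<mu> B) powr \<theta> * \<parallel>\<chi>\<^bsub>B\<^esub>\<parallel>\<close> with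
  \<open>\<theta> = (q - 1) / q\<close>, so by concavity the annulus contributes
  \<open>O(2 powr (k * (n * (1 - \<theta>) - \<delta>)))\<close>. The series converges as soon as \<open>\<delta> > n\<^sub>0 * (1 - \<theta>)\<close>, which is
  weaker than the assumed bound because \<open>N\<^sub>0 \<ge> 0\<close>, \<open>\<alpha>\<^sub>0 \<le> n\<^sub>0\<close> and \<open>i(\<phi>) \<le> 1 \<le> p(\<phi>)\<close>.\<close>

section \<open>Extended nonnegative arithmetic, dyadic scales and sums of powers\<close>

lemma ennpowr_1: "ennpowr x 1 = x"
  by (cases x) (auto simp: ennpowr_def)

lemma ennreal_inverse_antimono:
  fixes a b :: ennreal
  assumes "a \<le> b"
  shows "inverse b \<le> inverse a"
proof (cases "a = 0 \<or> b = top")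
  case False
  then obtain x y where "a = ennreal x" "b = ennreal y" "0 < x" "0 \<le> y"
    using assms by (cases a; cases b) (auto simp: top_unique)
  moreover from this have "x \<le> y" using assms by (simp add: ennreal_le_iff)
  ultimately show ?thesis by (simp add: inverse_ennreal ennreal_leI le_imp_inverse_le)
qed auto

text \<open>Cancellation survives only as an inequality: for \<open>b = 0\<close> and
  \<open>b = top\<close> the left side is \<open>0\<close>. In this form it cancels the norm of a
  ball without a proof that the norm is positive.\<close>

lemma ennreal_inverse_mult_cancel_le:
  fixes b :: ennreal
  assumes "0 < a"
  shows "inverse (ennreal a * b) * b \<le> ennreal (1 / a)"
proof (cases b)
  case (real c)
  show ?thesis
  proof (cases "c = 0")
    case False
    then have "0 < c" using real by simp
    then have "inverse (ennreal a * b) = ennreal (inverse (a * c))"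
      using assms real ennreal_mult[of a c] inverse_ennreal[of "a * c"] by simp
    then have "inverse (ennreal a * b) * b = ennreal (inverse (a * c) * c)"
      using assms real \<open>0 < c\<close> ennreal_mult[of "inverse (a * c)" c] by simp
    also have "inverse (a * c) * c = 1 / a" using \<open>0 < c\<close> by (simp add: field_simps)
    finally show ?thesis by simp
  qed (use real in simp)
qed (use assms in \<open>simp add: ennreal_mult_top\<close>)

text \<open>For \<open>b = 0\<close> a nonzero \<open>x\<close> would make the quotient infinite, so
  finiteness of \<open>N\<close> forces \<open>x = 0\<close>. Finiteness of \<open>b\<close>
  excludes \<open>x / top = 0\<close>, which carries no information on \<open>x\<close>.\<close>

lemma ennreal_le_mult_of_divide_le:
  fixes x b N :: ennreal
  assumes "x / b \<le> N" "b < \<infinity>" "N < \<infinity>"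
  shows "x \<le> N * b"
proof (cases "b = 0")
  case True
  then show ?thesis using assms by (cases "x = 0") (auto simp: top_unique)
next
  case False
  have "x = x * b / b" by (rule mult_divide_eq_ennreal[symmetric]) (use False assms in auto)
  also have "\<dots> = x / b * b" by (simp add: divide_ennreal_def mult_ac)
  also have "\<dots> \<le> N * b" using assms(1) by (rule mult_right_mono) simp
  finally show ?thesis .
qed

lemma dyadic_obtain:
  fixes y :: real
  assumes "1 \<le> y"
  obtains k where "2 ^ k \<le> y" "y < 2 ^ Suc k"
proof -
  have "\<exists>j. y < 2 ^ j" using real_arch_pow[of 2 y] by simp
  from exists_least_lemma[OF _ this] assms obtain k where "\<not> y < 2 ^ k" "y < 2 ^ Suc k" by auto
  with that[of k] show thesis by simp
qed

text \<open>The concavity estimate for sums of \<open>\<theta>\<close>-th powers. Each power is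
  bounded by a linear function of \<open>u x\<close>, namely
  \<open>c powr \<theta> + u x * c powr (\<theta> - 1)\<close>: the first term suffices for
  \<open>u x \<le> c\<close>, the second otherwise.\<close>

lemma sum_powr_le:
  fixes u :: "'b \<Rightarrow> real"
  assumes "finite F" "0 \<le> \<theta>" "\<theta> \<le> 1" "real (card F) \<le> P" "1 \<le> P" "\<And>x. x \<in> F \<Longrightarrow> 0 < u x" "sum u F \<le> K"
  shows "(\<Sum>x\<in>F. u x powr \<theta>) \<le> (1 + K) * P powr (1 - \<theta>)"
proof -
  \<comment> \<open>The size of a summand when \<open>P\<close> equal summands add up to
    \<open>1\<close>; with it both terms contribute a multiple of
    \<open>P powr (1 - \<theta>)\<close>.\<close>
  define c where "c = 1 / P"
  have c: "0 < c" using assms(5) by (simp add: c_def)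
  have "u x powr \<theta> \<le> c powr \<theta> + u x * c powr (\<theta> - 1)" if "x \<in> F" for x
  proof (cases "u x \<le> c")
    case True
    then have "u x powr \<theta> \<le> c powr \<theta>" using assms(2,6) that by (intro powr_mono2) (auto intro: less_imp_le)
    moreover have "0 \<le> u x * c powr (\<theta> - 1)" using assms(6)[OF that] by simp
    ultimately show ?thesis by linarith
  next
    case False
    have "u x powr \<theta> = u x * u x powr (\<theta> - 1)" using assms(6)[OF that] by (simp add: powr_diff)
    also have "\<dots> \<le> u x * c powr (\<theta> - 1)"
      using assms(3) assms(6)[OF that] False c by (intro mult_left_mono powr_mono2') auto
    finally show ?thesis by (simp add: add_increasing)
  qed
  then have "(\<Sum>x\<in>F. u x powr \<theta>) \<le> (\<Sum>x\<in>F. c powr \<theta> + u x * c powr (\<theta> - 1))" by (rule sum_mono)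
  also have "\<dots> = real (card F) * c powr \<theta> + sum u F * c powr (\<theta> - 1)"
    by (simp add: sum.distrib sum_distrib_right)
  also have "\<dots> \<le> P * c powr \<theta> + K * c powr (\<theta> - 1)"
    using assms by (intro add_mono mult_right_mono) auto
  also have "c powr \<theta> = 1 / P powr \<theta>" using assms(5) by (simp add: c_def powr_divide)
  also have "c powr (\<theta> - 1) = P powr (1 - \<theta>)" using assms(5)
    by (simp add: c_def powr_divide powr_diff)
  also have "P * (1 / P powr \<theta>) = P powr (1 - \<theta>)" using assms(5) by (simp add: powr_diff)
  finally show ?thesis by (simp add: algebra_simps)
qed

section \<open>Volume and coverings\<close>

locale homogeneous_space =
  fixes d :: "'a \<Rightarrow> 'a \<Rightarrow> real" and \<mu> :: "'a measure"
  assumes homogeneous: "homogeneous_type d \<mu>"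
begin

section \<open>Balls, their measures and measurability\<close>

lemma d_nonneg [simp]: "0 \<le> d x y"
  and d_self [simp]: "d x x = 0"
  and d_commute: "d x y = d y x"
  using homogeneous unfolding homogeneous_type_def quasi_metric_def by auto

lemma space_eq [simp]: "space \<mu> = UNIV"
  and qball_sets [measurable]: "0 < r \<Longrightarrow> qball d x r \<in> sets \<mu>"
  using homogeneous unfolding homogeneous_type_def by auto

lemma quasi_triangle:
  obtains C1 where "1 \<le> C1" "\<And>x y z. d x y \<le> C1 * (d x z + d z y)"
  using homogeneous unfolding homogeneous_type_def quasi_metric_def by auto

lemma emeasure_qball: "0 < r \<Longrightarrow> emeasure \<mu> (qball d x r) = ennreal (measure \<mu> (qball d x r))"
  using homogeneous unfolding homogeneous_type_def
  by (simp add: emeasure_eq_ennreal_measure less_top)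

lemma measure_qball_pos:
  assumes "0 < r" shows "0 < measure \<mu> (qball d x r)"
proof -
  have "0 < emeasure \<mu> (qball d x r)"
    using homogeneous assms unfolding homogeneous_type_def by auto
  then show ?thesis
    using emeasure_qball[OF assms, of x] by simp
qed

lemma fmeasurable_qball: "0 < r \<Longrightarrow> qball d x r \<in> fmeasurable \<mu>"
  by (rule fmeasurableI) (auto simp: emeasure_qball)

lemma qball_mono: "r \<le> s \<Longrightarrow> qball d x r \<subseteq> qball d x s"
  by (auto simp: qball_def)

lemma measure_qball_subset:
  assumes "qball d x r \<subseteq> qball d y s" "0 < r" "0 < s"
  shows "measure \<mu> (qball d x r) \<le> measure \<mu> (qball d y s)"
  using assms by (intro measure_mono_fmeasurable) (auto intro: fmeasurable_qball qball_sets)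

lemma sigma_finite: "sigma_finite_measure \<mu>"
proof
  \<comment> \<open>The goal mentions no point; any element of the type serves as the common centre
    of the exhausting balls.\<close>
  fix x :: 'a
  let ?A = "range (\<lambda>n. qball d x (real (Suc n)))"
  have "y \<in> \<Union>?A" for y
  proof -
    obtain n where "d y x < real n" using reals_Archimedean2 by blast
    then have "y \<in> qball d x (real (Suc n))" by (simp add: qball_def)
    then show ?thesis by blast
  qed
  then have "countable ?A \<and> ?A \<subseteq> sets \<mu> \<and> \<Union>?A = space \<mu> \<and> (\<forall>a\<in>?A. emeasure \<mu> a \<noteq> \<infinity>)"
    by (auto simp: qball_sets emeasure_qball simp del: of_nat_Suc)
  then show "\<exists>A. countable A \<and> A \<subseteq> sets \<mu> \<and> \<Union>A = space \<mu> \<and> (\<forall>a\<in>A. emeasure \<mu> a \<noteq> \<infinity>)"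
    by blast
qed

text \<open>Joint measurability of the kernel passes to the integral over one variable because
  \<open>\<mu>\<close> is sigma-finite. This makes \<open>f - A_op \<mu> a t f\<close> measurable,
  so that its integral can be split over coverings.\<close>

lemma borel_measurable_A_op [measurable]:
  assumes "(\<lambda>(x, y). a t x y) \<in> borel_measurable (\<mu> \<Otimes>\<^sub>M \<mu>)" "f \<in> borel_measurable \<mu>"
  shows "A_op \<mu> a t f \<in> borel_measurable \<mu>"
proof -
  interpret sigma_finite_measure \<mu> by (rule sigma_finite)
  have "(\<lambda>(x, y). a t x y * f y) = (\<lambda>z. (\<lambda>(x, y). a t x y) z * f (snd z))"
    by (auto simp: fun_eq_iff)
  also have "\<dots> \<in> borel_measurable (\<mu> \<Otimes>\<^sub>M \<mu>)"
    using assms by measurable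
  finally have "(\<lambda>x. \<integral>y. a t x y * f y \<partial>\<mu>) \<in> borel_measurable \<mu>"
    by (rule borel_measurable_lebesgue_integral)
  then show ?thesis
    using assms(2) by (cases "t = 0") (auto simp: A_op_def[abs_def])
qed

text \<open>Iterated doubling gives a power law with exponent about \<open>log 2 C2\<close>. Hence
  the infimum in \<open>deg_n\<close> is taken over a nonempty set.\<close>

lemma cond_D_exists: "\<exists>n. cond_D d \<mu> n"
proof -
  obtain C2 where C2: "1 \<le> C2"
    "\<And>x r. 0 < r \<Longrightarrow> measure \<mu> (qball d x (2 * r)) \<le> C2 * measure \<mu> (qball d x r)"
    using homogeneous unfolding homogeneous_type_def by auto
  have pow: "measure \<mu> (qball d x (2 ^ k * r)) \<le> C2 ^ k * measure \<mu> (qball d x r)"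
    if "0 < r" for x r k
  proof (induction k)
    case (Suc k)
    have "measure \<mu> (qball d x (2 ^ Suc k * r)) \<le> C2 * measure \<mu> (qball d x (2 ^ k * r))"
      using C2(2)[of "2 ^ k * r" x] that by (simp add: mult.assoc)
    also have "\<dots> \<le> C2 * (C2 ^ k * measure \<mu> (qball d x r))"
      using Suc C2(1) by (intro mult_left_mono) auto
    finally show ?case by (simp add: mult.assoc)
  qed simp
  \<comment> \<open>The summand \<open>1\<close> keeps the exponent positive when
    \<open>C2 = 1\<close>.\<close>
  define n where "n = log 2 C2 + 1"
  have n: "0 < n" unfolding n_def using C2(1) by (simp add: add_nonneg_pos)
  have "measure \<mu> (qball d x (l * r)) \<le> C2 * l powr n * measure \<mu> (qball d x r)"
    if "0 < r" "1 \<le> l" for x r l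
  proof -
    define k where "k = nat \<lceil>log 2 l\<rceil>"
    have log_l: "0 \<le> log 2 l" using that by simp
    then have k: "log 2 l \<le> real k" "real k \<le> log 2 l + 1" by (auto simp: k_def)
    have "l = 2 powr log 2 l" using that by simp
    also have "\<dots> \<le> 2 powr real k" using k by (intro powr_mono) auto
    finally have "l \<le> 2 ^ k" by (simp add: powr_realpow)
    then have "measure \<mu> (qball d x (l * r)) \<le> measure \<mu> (qball d x (2 ^ k * r))"
      using that by (intro measure_qball_subset qball_mono mult_right_mono) auto
    also have "\<dots> \<le> C2 ^ k * measure \<mu> (qball d x r)" by (rule pow) fact
    also have "C2 ^ k \<le> C2 * l powr n"
    proof -
      have "C2 ^ k = C2 powr real k" using C2(1) by (simp add: powr_realpow)
      also have "\<dots> \<le> C2 powr (log 2 l + 1)" using k C2(1) by (intro powr_mono) auto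
      also have "\<dots> = C2 * C2 powr log 2 l" using C2(1) by (simp add: powr_add)
      also have "C2 powr log 2 l = l powr log 2 C2"
        using C2(1) that by (simp add: powr_def log_def)
      also have "\<dots> \<le> l powr n" using that by (intro powr_mono) (auto simp: n_def)
      finally show ?thesis using C2(1) by simp
    qed
    finally show ?thesis by (simp add: mult_right_mono)
  qed
  then show ?thesis using n unfolding cond_D_def by blast
qed

lemma cond_D_obtain:
  assumes "cond_D d \<mu> n"
  obtains C where "1 \<le> C" "0 < n" "\<And>x r l. \<lbrakk>0 < r; 1 \<le> l\<rbrakk> \<Longrightarrow>
    measure \<mu> (qball d x (l * r)) \<le> C * l powr n * measure \<mu> (qball d x r)"
proof -
  obtain C where C: "0 < n" "\<And>x r l. \<lbrakk>0 < r; 1 \<le> l\<rbrakk> \<Longrightarrow>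
    measure \<mu> (qball d x (l * r)) \<le> C * l powr n * measure \<mu> (qball d x r)"
    using assms unfolding cond_D_def by blast
  show thesis
  proof (rule that[of "max 1 C"])
    fix x :: 'a and r l :: real assume "0 < r" "1 \<le> l"
    then have "measure \<mu> (qball d x (l * r)) \<le> C * l powr n * measure \<mu> (qball d x r)"
      by (rule C)
    also have "\<dots> \<le> max 1 C * l powr n * measure \<mu> (qball d x r)"
      by (intro mult_right_mono) auto
    finally show "measure \<mu> (qball d x (l * r)) \<le> max 1 C * l powr n * measure \<mu> (qball d x r)" .
  qed (use C in auto)
qed

text \<open>The ball about \<open>y\<close> lies in the ball about \<open>x\<close> of radius
  \<open>C1 * (r + d x y)\<close>, so every doubling exponent is also admissible here. This makes
  the infimum in \<open>deg_N\<close> one over a nonempty set.\<close>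

lemma cond_E_exists: "\<exists>N. cond_E d \<mu> N"
proof -
  obtain n where "cond_D d \<mu> n" using cond_D_exists by blast
  from cond_D_obtain[OF this] obtain C where C: "1 \<le> C" "0 < n" "\<And>x r l. \<lbrakk>0 < r; 1 \<le> l\<rbrakk> \<Longrightarrow>
    measure \<mu> (qball d x (l * r)) \<le> C * l powr n * measure \<mu> (qball d x r)"
    by metis
  obtain C1 where C1: "1 \<le> C1" "\<And>x y z. d x y \<le> C1 * (d x z + d z y)"
    using quasi_triangle by metis
  have "measure \<mu> (qball d y r) \<le> C * C1 powr n * (1 + d x y / r) powr n * measure \<mu> (qball d x r)"
    if "0 < r" for x y r
  proof -
    let ?l = "C1 * (1 + d x y / r)"
    have l: "1 \<le> ?l" using C1(1) that mult_mono[of 1 C1 1 "1 + d x y / r"] by simp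
    have "qball d y r \<subseteq> qball d x (?l * r)"
    proof
      fix z assume "z \<in> qball d y r"
      then have "d z y < r" by (simp add: qball_def)
      have "d z x \<le> C1 * (d z y + d y x)" by (rule C1)
      also have "\<dots> < C1 * (r + d x y)" using C1(1) \<open>d z y < r\<close> by (simp add: d_commute[of y x])
      also have "\<dots> = ?l * r" using that by (simp add: field_simps)
      finally show "z \<in> qball d x (?l * r)" by (simp add: qball_def)
    qed
    then have "measure \<mu> (qball d y r) \<le> measure \<mu> (qball d x (?l * r))"
      using that l by (intro measure_qball_subset) auto
    also have "\<dots> \<le> C * ?l powr n * measure \<mu> (qball d x r)" by (rule C) (use that l in auto)
    also have "?l powr n = C1 powr n * (1 + d x y / r) powr n"
      using C1(1) that by (intro powr_mult)
    finally show ?thesis by (simp add: mult.assoc)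
  qed
  then show ?thesis using C(2) unfolding cond_E_def by (intro exI[of _ n]) (auto intro: less_imp_le)
qed

text \<open>For exponent \<open>0\<close> the condition is monotonicity of the measure; the supremum
  in \<open>deg_alpha\<close> is thus over a nonempty set.\<close>

lemma cond_R_0: "cond_R d \<mu> 0"
  unfolding cond_R_def
proof (intro conjI allI impI exI[of _ 1])
  fix x r l assume H: "0 < r \<and> ereal r < 2 * qdiam d \<and> 1 \<le> l \<and> ereal l < 2 * qdiam d / ereal r"
  then have "measure \<mu> (qball d x r) \<le> measure \<mu> (qball d x (l * r))"
    using mult_right_mono[of 1 l r] by (intro measure_qball_subset qball_mono) auto
  with H show "inverse 1 * l powr 0 * measure \<mu> (qball d x r) \<le> measure \<mu> (qball d x (l * r))"
    by simp
qed (auto simp: cond_D_def)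

lemma deg_n_nonneg: "0 \<le> deg_n d \<mu>"
  unfolding deg_n_def using cond_D_exists by (intro cInf_greatest) (auto simp: cond_D_def)

lemma deg_N_nonneg: "0 \<le> deg_N d \<mu>"
  unfolding deg_N_def using cond_E_exists by (intro cInf_greatest) (auto simp: cond_E_def)

lemma deg_alpha_le_deg_n: "deg_alpha d \<mu> \<le> deg_n d \<mu>"
  unfolding deg_n_def
proof (rule cInf_greatest)
  show "{n. cond_D d \<mu> n} \<noteq> {}" using cond_D_exists by blast
  fix n assume "n \<in> {n. cond_D d \<mu> n}"
  then show "deg_alpha d \<mu> \<le> n"
    unfolding deg_alpha_def
  proof (intro cSup_least)
    show "{\<alpha>. cond_R d \<mu> \<alpha>} \<noteq> {}" using cond_R_0 by blast
  qed (simp add: cond_R_def)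
qed

text \<open>A separated subset of the ball of maximal cardinality is a net; the cardinality of
  separated subsets is bounded because the balls of radius \<open>r / (2 * C1)\<close> around their points
  are disjoint and each carries a fraction of the measure controlled by \<open>R / r\<close>.\<close>

lemma covering:
  assumes "cond_D d \<mu> n"
  obtains L K where "1 \<le> L" "1 \<le> K"
    "\<And>x0 r R. \<lbrakk>0 < r; r \<le> R\<rbrakk> \<Longrightarrow> \<exists>F. finite F \<and> real (card F) \<le> K * (R / r) powr n \<and>
       qball d x0 R \<subseteq> (\<Union>x\<in>F. qball d x r) \<and> (\<forall>x\<in>F. qball d x r \<subseteq> qball d x0 (L * R)) \<and>
       (\<Sum>x\<in>F. measure \<mu> (qball d x r)) \<le> K * measure \<mu> (qball d x0 (L * R))"
proof -
  obtain C where C: "1 \<le> C" "0 < n" "\<And>x r l. \<lbrakk>0 < r; 1 \<le> l\<rbrakk> \<Longrightarrow>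
    measure \<mu> (qball d x (l * r)) \<le> C * l powr n * measure \<mu> (qball d x r)"
    using cond_D_obtain[OF assms] by metis
  obtain C1 where C1: "1 \<le> C1" "\<And>x y z. d x y \<le> C1 * (d x z + d z y)"
    using quasi_triangle by metis
  \<comment> \<open>A ball of radius \<open>r \<le> R\<close> centred in \<open>qball d x0 R\<close>
    reaches at most to distance \<open>C1 * (R + R)\<close> from \<open>x0\<close>.\<close>
  define L where "L = 2 * C1"
  \<comment> \<open>Seen from a point of \<open>qball d x0 R\<close>, the large ball has radius at
    most \<open>C1 * (2 * C1 * R + R) \<le> 3 * C1 ^ 2 * R\<close>, which is
    \<open>6 * C1 ^ 3 * (R / r)\<close> times the radius \<open>r / (2 * C1)\<close> of the disjoint
    balls.\<close>
  define K where "K = C * (6 * C1 ^ 3) powr n"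
  have C1p: "1 \<le> C1 ^ j" for j using C1(1) by simp
  have K: "C * L powr n \<le> K"
  proof -
    have "C1 * 1 \<le> C1 * C1 ^ 2" using C1(1) C1p by (intro mult_left_mono) auto
    then have "2 * C1 \<le> 6 * C1 ^ 3" using C1(1) by (simp add: power3_eq_cube power2_eq_square)
    then show ?thesis unfolding K_def L_def using C(1,2) C1(1)
      by (intro mult_left_mono powr_mono2) auto
  qed
  have "1 \<le> L powr n" using C1(1) C(2) by (intro ge_one_powr_ge_zero) (auto simp: L_def)
  then have "1 * 1 \<le> C * L powr n" using C(1) by (intro mult_mono) auto
  with K have K1: "1 \<le> K" by simp
  show thesis
  proof (rule that[of L K])
    fix x0 and r R :: real assume r: "0 < r" "r \<le> R"
    define s where "s = r / (2 * C1)"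
    have s: "0 < s" "s \<le> r" using r C1(1) by (auto simp: s_def field_simps)
    let ?B = "qball d x0 (L * R)"
    have LR: "0 < L * R" using r C1(1) by (simp add: L_def)
    define sep where "sep F \<longleftrightarrow> finite F \<and> F \<subseteq> qball d x0 R \<and>
      (\<forall>x\<in>F. \<forall>y\<in>F. x \<noteq> y \<longrightarrow> r \<le> d x y)" for F
    have sub: "qball d x r \<subseteq> ?B" if "x \<in> qball d x0 R" for x
    proof
      fix z assume "z \<in> qball d x r"
      then have "d z x + d x x0 < 2 * R" using that r by (simp add: qball_def)
      then have "C1 * (d z x + d x x0) < C1 * (2 * R)" using C1(1) by simp
      moreover have "d z x0 \<le> C1 * (d z x + d x x0)" by (rule C1)
      ultimately show "z \<in> ?B" by (simp add: qball_def L_def)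
    qed
    have sum_le: "(\<Sum>x\<in>F. measure \<mu> (qball d x s)) \<le> measure \<mu> ?B" if F: "sep F" for F
    proof -
      have disj: "disjoint_family_on (\<lambda>x. qball d x s) F"
        unfolding disjoint_family_on_def
      proof (intro ballI impI)
        fix x y assume xy: "x \<in> F" "y \<in> F" "x \<noteq> y"
        have False if "z \<in> qball d x s" "z \<in> qball d y s" for z
        proof -
          have "d x y \<le> C1 * (d x z + d z y)" by (rule C1)
          also have "\<dots> < C1 * (s + s)" using that C1(1)
            by (intro mult_strict_left_mono) (auto simp: qball_def d_commute[of x z])
          also have "\<dots> = r" using C1(1) by (simp add: s_def)
          finally show False using F xy by (force simp: sep_def)
        qed
        then show "qball d x s \<inter> qball d y s = {}" by blast
      qed
      have "(\<Sum>x\<in>F. measure \<mu> (qball d x s)) = measure \<mu> (\<Union>x\<in>F. qball d x s)"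
        using F s disj by (intro measure_finite_Union[symmetric])
          (auto simp: sep_def emeasure_qball qball_sets)
      also have "\<dots> \<le> measure \<mu> ?B"
      proof (intro measure_mono_fmeasurable fmeasurable_qball LR)
        show "(\<Union>x\<in>F. qball d x s) \<subseteq> ?B"
          using sub F qball_mono[OF s(2)] by (fastforce simp: sep_def)
        show "(\<Union>x\<in>F. qball d x s) \<in> sets \<mu>"
          using F s by (intro sets.finite_UN) (auto simp: sep_def qball_sets)
      qed
      finally show ?thesis .
    qed
    have card_le: "real (card F) \<le> K * (R / r) powr n" if F: "sep F" for F
    proof -
      let ?c = "K * (R / r) powr n"
      have "measure \<mu> ?B \<le> ?c * measure \<mu> (qball d x s)" if "x \<in> F" for x
      proof -
        have x: "d x x0 < R" using F that by (auto simp: sep_def qball_def)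
        let ?l = "6 * C1 ^ 3 * (R / r)"
        have Rr: "1 \<le> R / r" using r by simp
        have l: "1 \<le> ?l" using mult_mono[of 1 "6 * C1 ^ 3" 1 "R / r"] C1p[of 3] Rr C1(1) by simp
        have ls: "?l * s = 3 * C1 ^ 2 * R" using r C1(1)
          by (simp add: s_def field_simps power3_eq_cube power2_eq_square)
        have "?B \<subseteq> qball d x (?l * s)"
        proof
          fix z assume "z \<in> ?B"
          then have z: "d z x0 < 2 * C1 * R" by (simp add: qball_def L_def)
          have "R \<le> C1 * R" using C1(1) r by simp
          then have "d z x0 + d x0 x < 3 * C1 * R"
            using z x d_commute[of x x0] by linarith
          then have "C1 * (d z x0 + d x0 x) < C1 * (3 * C1 * R)" using C1(1) by simp
          moreover have "d z x \<le> C1 * (d z x0 + d x0 x)" by (rule C1)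
          ultimately show "z \<in> qball d x (?l * s)"
            unfolding ls by (simp add: qball_def power2_eq_square mult_ac)
        qed
        then have "measure \<mu> ?B \<le> measure \<mu> (qball d x (?l * s))"
          using LR r s C1(1) by (intro measure_qball_subset) auto
        also have "\<dots> \<le> C * ?l powr n * measure \<mu> (qball d x s)"
          by (rule C) (use s l in auto)
        also have "?l powr n = (6 * C1 ^ 3) powr n * (R / r) powr n"
          using r C1(1) by (intro powr_mult)
        finally show ?thesis by (simp add: K_def mult.assoc)
      qed
      then have "(\<Sum>x\<in>F. measure \<mu> ?B) \<le> (\<Sum>x\<in>F. ?c * measure \<mu> (qball d x s))"
        by (rule sum_mono)
      also have "\<dots> = ?c * (\<Sum>x\<in>F. measure \<mu> (qball d x s))" by (simp add: sum_distrib_left)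
      also have "\<dots> \<le> ?c * measure \<mu> ?B"
        using K1 by (intro mult_left_mono sum_le F) auto
      finally show ?thesis using measure_qball_pos[OF LR, of x0] by simp
    qed
    have "sep {}" by (simp add: sep_def)
    moreover have "\<forall>F. sep F \<longrightarrow> card F < Suc (nat \<lfloor>K * (R / r) powr n\<rfloor>)"
      using card_le by (simp add: le_nat_floor less_Suc_eq_le)
    ultimately obtain F where F: "sep F" "\<And>G. sep G \<Longrightarrow> card G \<le> card F"
      using ex_has_greatest_nat[of sep "{}" card] by blast
    have cover: "qball d x0 R \<subseteq> (\<Union>x\<in>F. qball d x r)"
    proof (rule ccontr)
      assume "\<not> ?thesis"
      then obtain y where y: "y \<in> qball d x0 R" "\<And>x. x \<in> F \<Longrightarrow> r \<le> d y x"
        by (force simp: qball_def)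
      \<comment> \<open>An uncovered point is at distance at least \<open>r\<close> from all of
        \<open>F\<close>, so adding it would give a larger separated set.\<close>
      have "y \<notin> F" using y(2)[of y] r by auto
      have "sep (insert y F)" using F(1) y by (auto simp: sep_def d_commute)
      from F(2)[OF this] \<open>y \<notin> F\<close> F(1) show False by (auto simp: sep_def)
    qed
    have "measure \<mu> (qball d x r) \<le> K * measure \<mu> (qball d x s)" for x
    proof -
      have "r = L * s" using C1(1) by (simp add: s_def L_def)
      then have "measure \<mu> (qball d x r) \<le> C * L powr n * measure \<mu> (qball d x s)"
        using C(3)[of s L x] s C1(1) by (simp add: L_def)
      also have "\<dots> \<le> K * measure \<mu> (qball d x s)" using K by (intro mult_right_mono) auto
      finally show ?thesis .
    qed
    then have "(\<Sum>x\<in>F. measure \<mu> (qball d x r)) \<le> (\<Sum>x\<in>F. K * measure \<mu> (qball d x s))"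
      by (rule sum_mono)
    also have "\<dots> = K * (\<Sum>x\<in>F. measure \<mu> (qball d x s))" by (simp add: sum_distrib_left)
    also have "\<dots> \<le> K * measure \<mu> ?B" using K1 by (intro mult_left_mono sum_le F) auto
    finally have "(\<Sum>x\<in>F. measure \<mu> (qball d x r)) \<le> K * measure \<mu> ?B" .
    then show "\<exists>F. finite F \<and> real (card F) \<le> K * (R / r) powr n \<and>
       qball d x0 R \<subseteq> (\<Union>x\<in>F. qball d x r) \<and> (\<forall>x\<in>F. qball d x r \<subseteq> qball d x0 (L * R)) \<and>
       (\<Sum>x\<in>F. measure \<mu> (qball d x r)) \<le> K * measure \<mu> (qball d x0 (L * R))"
      using F(1) card_le cover sub by (intro exI[of _ F]) (auto simp: sep_def)
  qed (use C1(1) K1 in \<open>auto simp: L_def\<close>)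
qed

lemma set_nn_integral_pos:
  fixes h :: "'a \<Rightarrow> ennreal"
  assumes [measurable]: "h \<in> borel_measurable \<mu>" "B \<in> sets \<mu>" and "0 < emeasure \<mu> B" "\<And>x. 0 < h x"
  shows "0 < (\<integral>\<^sup>+x\<in>B. h x \<partial>\<mu>)"
proof -
  have "{x \<in> space \<mu>. h x * indicator B x \<noteq> 0} = B"
    using assms(4) by (auto simp: indicator_def less_le)
  moreover have "(\<integral>\<^sup>+x\<in>B. h x \<partial>\<mu>) = 0 \<longleftrightarrow> emeasure \<mu> {x \<in> space \<mu>. h x * indicator B x \<noteq> 0} = 0"
    by (rule nn_integral_0_iff) measurable
  ultimately show ?thesis using assms(3) by (simp add: less_le)
qed

lemma sup_balls_le_obtain:
  fixes F :: "real \<Rightarrow> 'a set \<Rightarrow> ennreal"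
  assumes "(SUP t\<in>{0<..}. sup_balls d (F t)) < \<infinity>"
  obtains Q where "0 \<le> Q" "\<And>t z r. \<lbrakk>0 < t; 0 < r\<rbrakk> \<Longrightarrow> F t (qball d z r) \<le> ennreal Q"
proof -
  let ?S = "SUP t\<in>{0<..}. sup_balls d (F t)"
  have "F t (qball d z r) \<le> ?S" if "0 < t" "0 < r" for t :: real and z r
  proof -
    have "F t (qball d z r) \<le> (SUP r\<in>{0<..}. F t (qball d z r))"
      using that by (intro SUP_upper) auto
    also have "\<dots> \<le> sup_balls d (F t)" unfolding sup_balls_def by (rule SUP_upper) auto
    also have "\<dots> \<le> ?S" using that by (intro SUP_upper) auto
    finally show ?thesis .
  qed
  moreover have "?S = ennreal (enn2real ?S)" using assms by simp
  ultimately show thesis using that[of "enn2real ?S"] by (metis enn2real_nonneg)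
qed

end

section \<open>Weights and Luxemburg norms of balls\<close>

text \<open>Usually written \<open>\<phi>(E, t)\<close>. Values are extended nonnegative, so that
  finiteness on balls is derived from the Muckenhoupt condition instead of being built in.\<close>

definition weight :: "'a measure \<Rightarrow> ('a \<Rightarrow> real \<Rightarrow> real) \<Rightarrow> 'a set \<Rightarrow> real \<Rightarrow> ennreal" where
  "weight \<mu> \<phi> E t = (\<integral>\<^sup>+x\<in>E. ennreal (\<phi> x t) \<partial>\<mu>)"

locale growth = homogeneous_space d \<mu> for d :: "'a \<Rightarrow> 'a \<Rightarrow> real" and \<mu> :: "'a measure" +
  fixes \<phi> :: "'a \<Rightarrow> real \<Rightarrow> real"
  assumes growth_function: "growth_function d \<mu> \<phi>"
begin

section \<open>Elementary properties of growth functions and weights\<close>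

lemma phi_zero: "\<phi> x 0 = 0"
  and phi_pos: "0 < t \<Longrightarrow> 0 < \<phi> x t"
  and phi_mono: "\<lbrakk>0 \<le> s; s \<le> t\<rbrakk> \<Longrightarrow> \<phi> x s \<le> \<phi> x t"
  and phi_measurable: "0 \<le> t \<Longrightarrow> (\<lambda>x. \<phi> x t) \<in> borel_measurable \<mu>"
  using growth_function unfolding growth_function_def orlicz_def mono_on_def by auto

lemma weight_mono_set: "E \<subseteq> F \<Longrightarrow> weight \<mu> \<phi> E t \<le> weight \<mu> \<phi> F t"
  unfolding weight_def by (intro nn_integral_mono) (auto simp: indicator_def)

lemma weight_le_scale:
  assumes "0 \<le> s" "0 \<le> t" "0 \<le> c" "E \<in> sets \<mu>" "\<And>x. \<phi> x s \<le> c * \<phi> x t"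
  shows "weight \<mu> \<phi> E s \<le> ennreal c * weight \<mu> \<phi> E t"
proof -
  note phi_measurable[OF assms(2), measurable] assms(4)[measurable]
  have "weight \<mu> \<phi> E s \<le> (\<integral>\<^sup>+x. ennreal c * (ennreal (\<phi> x t) * indicator E x) \<partial>\<mu>)"
    unfolding weight_def using assms(3,5)
    by (intro nn_integral_mono) (auto simp: indicator_def ennreal_mult'[symmetric] intro: ennreal_leI)
  also have "\<dots> = ennreal c * weight \<mu> \<phi> E t"
    unfolding weight_def by (rule nn_integral_cmult) measurable
  finally show ?thesis .
qed

lemma weight_qball_pos: "\<lbrakk>0 < t; 0 < r\<rbrakk> \<Longrightarrow> 0 < weight \<mu> \<phi> (qball d z r) t"
  unfolding weight_def
  by (intro set_nn_integral_pos measurable_compose[OF phi_measurable])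
    (auto simp: emeasure_qball measure_qball_pos phi_pos qball_sets)

lemma upper_type_obtain:
  obtains C where "1 \<le> C" "\<And>x t s. \<lbrakk>0 \<le> t; 1 \<le> s\<rbrakk> \<Longrightarrow> \<phi> x (s * t) \<le> C * s * \<phi> x t"
proof -
  obtain C where C: "\<And>x t s. \<lbrakk>0 \<le> t; 1 \<le> s\<rbrakk> \<Longrightarrow> \<phi> x (s * t) \<le> C * s powr 1 * \<phi> x t"
    using growth_function unfolding growth_function_def upper_type_def by blast
  have "1 * \<phi> x 1 \<le> C * \<phi> x 1" for x using C[of 1 1 x] by simp
  then have "1 \<le> C" using phi_pos[of 1] by (meson mult_right_le_imp_le zero_less_one)
  with C show thesis by (intro that[of C]) auto
qed

text \<open>Raising the constant to at least \<open>1\<close> admits the endpoint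
  \<open>s = 1\<close>, which \<open>lower_type\<close> leaves out and which occurs when a rescaling
  factor equals \<open>1\<close>.\<close>

lemma lower_type_obtain:
  obtains p C where "0 < p" "1 \<le> C"
    "\<And>x t s. \<lbrakk>0 \<le> t; 0 < s; s \<le> 1\<rbrakk> \<Longrightarrow> \<phi> x (s * t) \<le> C * s powr p * \<phi> x t"
proof -
  obtain p C where p: "0 < p"
    and C: "\<And>x t s. \<lbrakk>0 \<le> t; 0 < s; s < 1\<rbrakk> \<Longrightarrow> \<phi> x (s * t) \<le> C * s powr p * \<phi> x t"
    using growth_function unfolding growth_function_def lower_type_def by blast
  show thesis
  proof (rule that[of p "max 1 C"])
    fix x and s t :: real assume st: "0 \<le> t" "0 < s" "s \<le> 1"
    have phi: "0 \<le> \<phi> x t" using phi_mono[of 0 t x] st by (simp add: phi_zero)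
    show "\<phi> x (s * t) \<le> max 1 C * s powr p * \<phi> x t"
    proof (cases "s = 1")
      case True
      then show ?thesis using phi mult_right_mono[of 1 "max 1 C" "\<phi> x t"] by simp
    next
      case False
      then have "\<phi> x (s * t) \<le> C * s powr p * \<phi> x t" using st by (intro C) auto
      also have "\<dots> \<le> max 1 C * s powr p * \<phi> x t" using phi by (intro mult_right_mono) auto
      finally show ?thesis .
    qed
  qed (use p in auto)
qed

text \<open>On \<open>B\<close> the reciprocal of the weight is almost everywhere at most its
  essential supremum, hence so is its average. With this inclusion an exponent \<open>p > 1\<close>
  can always be chosen.\<close>

lemma A_class_1_imp_2:
  assumes "A_class d \<mu> 1 \<phi>"
  shows "A_class d \<mu> 2 \<phi>"
proof -
  have "avg \<mu> B (\<lambda>x. ennreal (\<phi> x t)) * ennpowr (avg \<mu> B (\<lambda>x. ennreal (\<phi> x t powr (- 1 / (2 - 1))))) (2 - 1)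
    \<le> avg \<mu> B (\<lambda>x. ennreal (\<phi> x t)) * esssup (restrict_space \<mu> B) (\<lambda>y. inverse (ennreal (\<phi> y t)))"
    if "0 < t" "0 < r" "B = qball d z r" for B t r z
  proof (rule mult_left_mono)
    have [measurable]: "B \<in> sets \<mu>" using that by (simp add: qball_sets)
    let ?S = "esssup (restrict_space \<mu> B) (\<lambda>y. inverse (ennreal (\<phi> y t)))"
    have "AE y in \<mu>. y \<in> B \<longrightarrow> inverse (ennreal (\<phi> y t)) \<le> ?S"
      using esssup_AE[of "\<lambda>y. inverse (ennreal (\<phi> y t))" "restrict_space \<mu> B"]
      by (subst (asm) AE_restrict_space_iff) auto
    then have "AE y in \<mu>. ennreal (\<phi> y t powr (- 1 / (2 - 1))) * indicator B y \<le> ?S * indicator B y"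
      by eventually_elim
        (auto simp: indicator_def inverse_ennreal phi_pos abs_of_pos \<open>0 < t\<close> powr_minus)
    then have "(\<integral>\<^sup>+y\<in>B. ennreal (\<phi> y t powr (- 1 / (2 - 1))) \<partial>\<mu>) \<le> ?S * emeasure \<mu> B"
      by (subst nn_integral_cmult_indicator[symmetric]) (auto intro: nn_integral_mono_AE)
    then have "avg \<mu> B (\<lambda>x. ennreal (\<phi> x t powr (- 1 / (2 - 1)))) \<le> ?S * emeasure \<mu> B / emeasure \<mu> B"
      unfolding avg_def by (rule divide_right_mono_ennreal)
    also have "\<dots> = ?S" using that measure_qball_pos[OF that(2), of z]
      by (intro mult_divide_eq_ennreal) (auto simp: emeasure_qball)
    finally show "ennpowr (avg \<mu> B (\<lambda>x. ennreal (\<phi> x t powr (- 1 / (2 - 1))))) (2 - 1) \<le> ?S"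
      by (simp add: ennpowr_1)
  qed simp
  then have "(SUP t\<in>{0<..}. sup_balls d (\<lambda>B. avg \<mu> B (\<lambda>x. ennreal (\<phi> x t)) *
      ennpowr (avg \<mu> B (\<lambda>x. ennreal (\<phi> x t powr (- 1 / (2 - 1))))) (2 - 1)))
    \<le> (SUP t\<in>{0<..}. sup_balls d (\<lambda>B. avg \<mu> B (\<lambda>x. ennreal (\<phi> x t)) *
      esssup (restrict_space \<mu> B) (\<lambda>y. inverse (ennreal (\<phi> y t)))))"
    unfolding sup_balls_def by (intro SUP_subset_mono order_refl) simp
  also have "\<dots> < \<infinity>" using assms by (simp add: A_class_def)
  finally show ?thesis by (simp add: A_class_def)
qed

text \<open>The \<open>A\<^sub>p\<close> condition is used through the pointwise inequality
  \<open>1 \<le> w powr (- 1 / (p - 1)) / c + c powr (p - 1) * w\<close>, integrated over \<open>E\<close>, with \<open>c\<close> chosen such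
  that the first term contributes at most half of the measure of \<open>E\<close>; this replaces
  the usual appeal to Hoelder's inequality.\<close>

lemma weight_doubling:
  obtains K p where "1 \<le> K" "1 \<le> p"
    "\<And>t z r E l. \<lbrakk>0 < t; 0 < r; E \<in> sets \<mu>; E \<subseteq> qball d z r; 0 < measure \<mu> E; 1 \<le> l;
        measure \<mu> (qball d z r) \<le> l * measure \<mu> E\<rbrakk> \<Longrightarrow>
      weight \<mu> \<phi> (qball d z r) t < \<infinity> \<and>
      weight \<mu> \<phi> (qball d z r) t \<le> ennreal (K * l powr p) * weight \<mu> \<phi> E t"
proof -
  obtain p where p: "1 < p" "A_class d \<mu> p \<phi>"
    using growth_function A_class_1_imp_2 unfolding growth_function_def
    by (metis less_le one_less_numeral_iff semiring_norm(76))
  then have "(SUP t\<in>{0<..}. sup_balls d (\<lambda>B. avg \<mu> B (\<lambda>x. ennreal (\<phi> x t)) *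
    ennpowr (avg \<mu> B (\<lambda>x. ennreal (\<phi> x t powr (- 1 / (p - 1))))) (p - 1))) < \<infinity>"
    by (auto simp: A_class_def)
  then obtain Q where Q: "0 \<le> Q" "\<And>t z r. \<lbrakk>0 < t; 0 < r\<rbrakk> \<Longrightarrow>
    avg \<mu> (qball d z r) (\<lambda>x. ennreal (\<phi> x t)) *
    ennpowr (avg \<mu> (qball d z r) (\<lambda>x. ennreal (\<phi> x t powr (- 1 / (p - 1))))) (p - 1) \<le> ennreal Q"
    by (rule sup_balls_le_obtain) blast
  define K where "K = max 1 (Q * 2 powr p)"
  show thesis
  proof (rule that[of K p])
    fix t r l :: real and z E
    assume H: "0 < t" "0 < r" "E \<in> sets \<mu>" "E \<subseteq> qball d z r" "0 < measure \<mu> E" "1 \<le> l"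
      "measure \<mu> (qball d z r) \<le> l * measure \<mu> E"
    define B where "B = qball d z r"
    define b where "b = measure \<mu> B"
    define e where "e = measure \<mu> E"
    define w where "w x = \<phi> x t" for x
    define v where "v x = w x powr (- 1 / (p - 1))" for x
    note H(3)[measurable]
    have [measurable]: "w \<in> borel_measurable \<mu>" "v \<in> borel_measurable \<mu>"
      using phi_measurable[of t] H(1) by (auto simp: w_def[abs_def] v_def[abs_def])
    have [measurable]: "B \<in> sets \<mu>" using H by (simp add: B_def qball_sets)
    have w: "0 < w x" for x using H by (simp add: w_def phi_pos)
    have v: "0 < v x" for x using w by (simp add: v_def less_imp_neq[symmetric])
    have b: "0 < b" "emeasure \<mu> B = ennreal b" using H
      by (auto simp: b_def B_def emeasure_qball measure_qball_pos)
    have e: "0 < e" "emeasure \<mu> E = ennreal e"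
      using H(5) by (auto simp: e_def measure_def enn2real_positive_iff)
    have be: "b \<le> l * e" using H by (simp add: b_def e_def B_def)
    define W where "W = (\<integral>\<^sup>+x\<in>B. ennreal (w x) \<partial>\<mu>)"
    define X where "X = (\<integral>\<^sup>+x\<in>B. ennreal (v x) \<partial>\<mu>)"
    have WX: "0 < W" "0 < X"
      using b w v unfolding W_def X_def by (auto intro!: set_nn_integral_pos)
    have AQ: "W / ennreal b * ennpowr (X / ennreal b) (p - 1) \<le> ennreal Q"
      using Q(2)[OF H(1,2), of z] unfolding avg_def W_def X_def b(2)[symmetric] v_def w_def B_def .
    have pos: "0 < W / ennreal b" "0 < X / ennreal b"
      using WX by (auto simp: ennreal_zero_less_divide)
    \<comment> \<open>Both factors in \<open>AQ\<close> are positive and their product is finite, so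
      neither is infinite. This yields integrability of \<open>w\<close> and \<open>v\<close> over
      \<open>B\<close>, and the argument continues with real numbers.\<close>
    have "0 < ennpowr (X / ennreal b) (p - 1)"
    proof (cases "X / ennreal b = \<infinity>")
      case False
      then obtain y where "X / ennreal b = ennreal y" "0 < y"
        using pos(2) by (cases "X / ennreal b") auto
      then show ?thesis by (simp add: ennpowr_def)
    qed (simp add: ennpowr_def)
    with AQ have "W / ennreal b \<noteq> \<infinity>" by (auto simp: ennreal_top_mult top_unique split: if_splits)
    moreover have "X / ennreal b \<noteq> \<infinity>"
    proof
      assume "X / ennreal b = \<infinity>"
      then have "W / ennreal b * top \<le> ennreal Q" using AQ by (simp add: ennpowr_def)
      moreover have "W / ennreal b * top = top"
        using pos(1) unfolding ennreal_mult_top by (simp add: less_le)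
      ultimately show False by (simp add: top_unique)
    qed
    ultimately have "W \<noteq> \<infinity>" "X \<noteq> \<infinity>" using b by (auto simp: ennreal_top_divide)
    then obtain Wr Xr where r: "W = ennreal Wr" "0 < Wr" "X = ennreal Xr" "0 < Xr"
      using WX by (cases W; cases X) auto
    have "ennreal (Wr / b * (Xr / b) powr (p - 1)) \<le> ennreal Q"
      using AQ r b by (simp add: divide_ennreal ennpowr_def ennreal_mult'[symmetric])
    then have A: "Wr / b * (Xr / b) powr (p - 1) \<le> Q" using Q(1) by (simp add: ennreal_le_iff)
    define c where "c = 2 * Xr / e"
    have c: "0 < c" using r e by (simp add: c_def)
    have pt: "1 \<le> v x / c + c powr (p - 1) * w x" for x
    proof (cases "c \<le> v x")
      case True
      then have "1 \<le> v x / c" using c by simp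
      moreover have "0 \<le> c powr (p - 1) * w x" using w[of x] by simp
      ultimately show ?thesis by linarith
    next
      case False
      have "v x powr (p - 1) = w x powr (- 1 / (p - 1) * (p - 1))"
        unfolding v_def by (rule powr_powr)
      also have "- 1 / (p - 1) * (p - 1) = - 1" using p(1) by simp
      finally have "w x * v x powr (p - 1) = 1"
        using w[of x] by (simp add: powr_minus)
      moreover have "v x powr (p - 1) \<le> c powr (p - 1)"
        using False v[of x] p(1) by (intro powr_mono2) auto
      ultimately have "1 \<le> c powr (p - 1) * w x"
        using mult_left_mono[of "v x powr (p - 1)" "c powr (p - 1)" "w x"] w[of x]
        by (simp add: mult.commute)
      moreover have "0 \<le> v x / c" using v[of x] c by simp
      ultimately show ?thesis by linarith
    qed
    have "ennreal e \<le> (\<integral>\<^sup>+x. ennreal (1 / c) * (ennreal (v x) * indicator B x) +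
      ennreal (c powr (p - 1)) * (ennreal (w x) * indicator E x) \<partial>\<mu>)"
    proof -
      have "ennreal e = (\<integral>\<^sup>+x. indicator E x \<partial>\<mu>)" using e by simp
      also have "\<dots> \<le> (\<integral>\<^sup>+x. ennreal (1 / c) * (ennreal (v x) * indicator B x) +
        ennreal (c powr (p - 1)) * (ennreal (w x) * indicator E x) \<partial>\<mu>)"
      proof (intro nn_integral_mono)
        fix x
        show "indicator E x \<le> ennreal (1 / c) * (ennreal (v x) * indicator B x) +
          ennreal (c powr (p - 1)) * (ennreal (w x) * indicator E x)"
        proof (cases "x \<in> E")
          case True
          then have "x \<in> B" using H by (auto simp: B_def)
          have "1 \<le> ennreal (v x / c + c powr (p - 1) * w x)"
            using pt[of x] by (simp add: ennreal_1[symmetric] del: ennreal_1)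
          also have "\<dots> = ennreal (1 / c) * ennreal (v x) + ennreal (c powr (p - 1)) * ennreal (w x)"
            using w[of x] v[of x] c by (simp add: ennreal_plus ennreal_mult'[symmetric])
          finally show ?thesis using True \<open>x \<in> B\<close> by simp
        qed auto
      qed
      finally show ?thesis .
    qed
    also have "\<dots> = ennreal (1 / c) * X + ennreal (c powr (p - 1)) * weight \<mu> \<phi> E t"
      by (simp add: nn_integral_add nn_integral_cmult X_def weight_def w_def[symmetric])
    finally have E1: "ennreal e \<le> ennreal (1 / c) * X + ennreal (c powr (p - 1)) * weight \<mu> \<phi> E t" .
    have "weight \<mu> \<phi> E t \<le> weight \<mu> \<phi> B t" using H by (intro weight_mono_set) (simp add: B_def)
    also have WB: "weight \<mu> \<phi> B t = ennreal Wr" by (simp add: weight_def w_def[symmetric] W_def[symmetric] r)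
    finally have "weight \<mu> \<phi> E t \<noteq> top" by (auto simp: top_unique)
    then obtain V where V: "weight \<mu> \<phi> E t = ennreal V" "0 \<le> V"
      by (cases "weight \<mu> \<phi> E t") auto
    have "ennreal e \<le> ennreal (Xr / c + c powr (p - 1) * V)"
      using E1 V r c by (simp add: ennreal_mult'[symmetric])
    moreover have "0 \<le> Xr / c + c powr (p - 1) * V" using V r c by simp
    ultimately have "e \<le> Xr / c + c powr (p - 1) * V" by (rule iffD1[OF ennreal_le_iff, rotated])
    moreover have "Xr / c = e / 2" using r e by (simp add: c_def)
    ultimately have eV: "e / 2 \<le> c powr (p - 1) * V" by linarith
    \<comment> \<open>The bound \<open>A\<close> solved for \<open>Wr\<close>. Replacing
      \<open>b\<close> by \<open>l * e\<close> and \<open>Xr\<close> by \<open>c * e / 2\<close>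
      leaves a multiple of \<open>(e / 2) / c powr (p - 1)\<close>, which \<open>eV\<close> bounds
      by \<open>V\<close>.\<close>
    have "Wr \<le> Q * b * (b / Xr) powr (p - 1)"
    proof -
      define y where "y = (Xr / b) powr (p - 1)"
      have y: "0 < y" "(b / Xr) powr (p - 1) = 1 / y" using b r by (auto simp: y_def powr_divide)
      have "Wr / b * y \<le> Q" using A by (simp add: y_def)
      then show ?thesis unfolding y(2) using b(1) y(1) by (simp add: field_simps)
    qed
    also have "\<dots> \<le> Q * (l * e) * (l * e / Xr) powr (p - 1)"
      using Q be b r p(1) H(6) e(1)
      by (intro mult_mono powr_mono2 divide_right_mono) auto
    also have "l * e / Xr = 2 * l / c" using r e by (simp add: c_def)
    also have "(2 * l / c) powr (p - 1) = 2 powr (p - 1) * l powr (p - 1) / c powr (p - 1)"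
      using H(6) c by (simp add: powr_divide powr_mult)
    also have "Q * (l * e) * (2 powr (p - 1) * l powr (p - 1) / c powr (p - 1)) =
      Q * 2 powr p * l powr p * ((e / 2) / c powr (p - 1))"
    proof -
      have "2 powr p = 2 * 2 powr (p - 1)" "l powr p = l * l powr (p - 1)"
        using H(6) by (auto simp: powr_diff)
      then show ?thesis by simp
    qed
    also have "\<dots> \<le> Q * 2 powr p * l powr p * V"
      using eV c Q(1) by (intro mult_left_mono) (auto simp: divide_le_eq mult.commute)
    also have "\<dots> \<le> K * l powr p * V"
      using V(2) by (intro mult_right_mono) (auto simp: K_def)
    finally have "ennreal Wr \<le> ennreal (K * l powr p) * ennreal V"
      using V(2) by (simp add: K_def ennreal_mult'[symmetric] ennreal_leI)
    with WB V show "weight \<mu> \<phi> (qball d z r) t < \<infinity> \<and>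
      weight \<mu> \<phi> (qball d z r) t \<le> ennreal (K * l powr p) * weight \<mu> \<phi> E t"
      by (simp add: B_def)
  qed (use p in \<open>auto simp: K_def\<close>)
qed

text \<open>A quantitative \<open>A\<^sub>\<infinity>\<close> condition. Keeping
  \<open>\<theta>\<close> as a parameter treats finite and infinite reverse Hoelder exponents, and
  the trivial exponent \<open>0\<close>, on the same footing.\<close>

definition weight_decay :: "real \<Rightarrow> bool" where
  "weight_decay \<theta> \<longleftrightarrow> (\<exists>K\<ge>1. \<forall>t>0. \<forall>z. \<forall>r>0. \<forall>E\<in>sets \<mu>. E \<subseteq> qball d z r \<longrightarrow>
     weight \<mu> \<phi> E t \<le>
       ennreal (K * (measure \<mu> E / measure \<mu> (qball d z r)) powr \<theta>) * weight \<mu> \<phi> (qball d z r) t)"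

lemma weight_null:
  assumes "E \<in> sets \<mu>" "emeasure \<mu> E = 0"
  shows "weight \<mu> \<phi> E t = 0"
  unfolding weight_def using assms by (intro nn_integral_null_set) auto

lemma weight_qball_finite:
  assumes "0 < t" "0 < r"
  shows "weight \<mu> \<phi> (qball d z r) t < \<infinity>"
proof -
  obtain K p where "1 \<le> K" "1 \<le> p" and K:
    "\<And>t z r E l. \<lbrakk>0 < t; 0 < r; E \<in> sets \<mu>; E \<subseteq> qball d z r; 0 < measure \<mu> E; 1 \<le> l;
        measure \<mu> (qball d z r) \<le> l * measure \<mu> E\<rbrakk> \<Longrightarrow>
      weight \<mu> \<phi> (qball d z r) t < \<infinity> \<and>
      weight \<mu> \<phi> (qball d z r) t \<le> ennreal (K * l powr p) * weight \<mu> \<phi> E t"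
    using weight_doubling by metis
  show ?thesis using K[OF assms qball_sets order_refl _ order_refl, of z] assms
    by (simp add: measure_qball_pos)
qed

lemma weight_qball_obtain:
  assumes "0 < t" "0 < r"
  obtains w where "0 < w" "weight \<mu> \<phi> (qball d z r) t = ennreal w"
  using weight_qball_finite[OF assms, of z] weight_qball_pos[OF assms, of z]
  by (cases "weight \<mu> \<phi> (qball d z r) t") auto

text \<open>As for \<open>weight_doubling\<close>, a pointwise inequality, here \<open>w \<le> c + c powr (1 - q) * w powr q\<close>
  with \<open>c\<close> balancing the two terms, replaces Hoelder's inequality.\<close>

lemma RH_class_imp_weight_decay:
  assumes "RH_class d \<mu> q \<phi>"
  shows "weight_decay (conj_quot q)"
proof -
  have q: "1 < q" and "(SUP t\<in>{0<..}. sup_balls d (\<lambda>B.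
        (if q = \<infinity> then esssup (restrict_space \<mu> B) (\<lambda>y. ennreal (\<phi> y t))
         else ennpowr (avg \<mu> B (\<lambda>x. ennreal (\<phi> x t powr real_of_ereal q))) (1 / real_of_ereal q)) *
        inverse (avg \<mu> B (\<lambda>x. ennreal (\<phi> x t))))) < \<infinity>"
    using assms by (auto simp: RH_class_def)
  from this(2) obtain Q where Q0: "0 \<le> Q" and Q: "\<And>t z r. \<lbrakk>0 < t; 0 < r\<rbrakk> \<Longrightarrow>
    (if q = \<infinity> then esssup (restrict_space \<mu> (qball d z r)) (\<lambda>y. ennreal (\<phi> y t))
         else ennpowr (avg \<mu> (qball d z r) (\<lambda>x. ennreal (\<phi> x t powr real_of_ereal q))) (1 / real_of_ereal q)) *
        inverse (avg \<mu> (qball d z r) (\<lambda>x. ennreal (\<phi> x t))) \<le> ennreal Q"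
    by (rule sup_balls_le_obtain) blast
  define K where "K = 1 + (if q = \<infinity> then Q else Q powr real_of_ereal q)"
  show ?thesis
    unfolding weight_decay_def
  proof (intro exI[of _ K] conjI allI impI ballI)
    show "1 \<le> K" using Q0 by (simp add: K_def)
    fix t r :: real and z E
    assume H: "0 < t" "0 < r" "E \<in> sets \<mu>" "E \<subseteq> qball d z r"
    define B where "B = qball d z r"
    define b where "b = measure \<mu> B"
    define e where "e = measure \<mu> E"
    define w where "w x = \<phi> x t" for x
    note H(3)[measurable]
    have [measurable]: "w \<in> borel_measurable \<mu>"
      using phi_measurable[of t] H(1) by (auto simp: w_def[abs_def])
    have [measurable]: "B \<in> sets \<mu>" using H by (simp add: B_def qball_sets)
    have w: "0 < w x" for x using H by (simp add: w_def phi_pos)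
    have b: "0 < b" "emeasure \<mu> B = ennreal b" using H
      by (auto simp: b_def B_def emeasure_qball measure_qball_pos)
    have "emeasure \<mu> E \<le> emeasure \<mu> B" using H by (intro emeasure_mono) (auto simp: B_def)
    with b have "emeasure \<mu> E \<noteq> \<infinity>" by (auto simp: top_unique)
    then have e: "emeasure \<mu> E = ennreal e" "0 \<le> e"
      by (auto simp: e_def emeasure_eq_ennreal_measure)
    obtain W where W: "0 < W" "weight \<mu> \<phi> B t = ennreal W"
      using weight_qball_obtain[OF H(1,2), of z] unfolding B_def by metis
    have avgB: "inverse (avg \<mu> B (\<lambda>x. ennreal (\<phi> x t))) = ennreal (b / W)"
      using W b unfolding avg_def weight_def by (simp add: divide_ennreal inverse_ennreal)
    show "weight \<mu> \<phi> E t \<le> ennreal (K * (measure \<mu> E / measure \<mu> (qball d z r)) powr conj_quot q) *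
      weight \<mu> \<phi> (qball d z r) t"
    \<comment> \<open>Null sets are treated apart because \<open>c\<close> below divides by
      \<open>e\<close>.\<close>
    proof (cases "e = 0")
      case True
      then show ?thesis using e H by (simp add: weight_null)
    next
      case False
      then have e0: "0 < e" using e by simp
      have "weight \<mu> \<phi> E t \<le> ennreal (K * (e / b) powr conj_quot q * W)"
      proof (cases "q = \<infinity>")
        case True
        let ?S = "esssup (restrict_space \<mu> B) (\<lambda>y. ennreal (\<phi> y t))"
        have S: "?S * ennreal (b / W) \<le> ennreal Q"
          using Q[OF H(1,2), of z] True avgB by (simp add: B_def)
        then have "?S \<noteq> \<infinity>" using b W by (auto simp: ennreal_top_mult top_unique split: if_splits)
        then obtain s where s: "?S = ennreal s" "0 \<le> s" by (cases ?S) auto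
        with S b W Q0 have "s * (b / W) \<le> Q" by (simp add: ennreal_mult'[symmetric] ennreal_le_iff)
        then have sQ: "s \<le> Q * W / b" using b W by (simp add: field_simps)
        have "AE y in \<mu>. y \<in> B \<longrightarrow> ennreal (\<phi> y t) \<le> ?S"
          using esssup_AE[of "\<lambda>y. ennreal (\<phi> y t)" "restrict_space \<mu> B"]
          by (subst (asm) AE_restrict_space_iff) auto
        then have "AE y in \<mu>. ennreal (\<phi> y t) * indicator E y \<le> ennreal s * indicator E y"
          by eventually_elim (use H s in \<open>auto simp: indicator_def B_def\<close>)
        then have "weight \<mu> \<phi> E t \<le> ennreal s * emeasure \<mu> E"
          unfolding weight_def
          by (subst nn_integral_cmult_indicator[symmetric]) (auto intro: nn_integral_mono_AE)
        also have "\<dots> = ennreal (s * e)" using s e by (simp add: ennreal_mult)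
        also have "s * e \<le> Q * W / b * e" using sQ e by (intro mult_right_mono)
        also have "\<dots> \<le> K * (e / b) powr conj_quot q * W"
          using True e0 b W by (simp add: K_def conj_quot_def field_simps)
        finally show ?thesis by (simp add: ennreal_leI)
      next
        case False
        then obtain s where s: "q = ereal s" "1 < s" using q by (cases q) auto
        define X where "X = (\<integral>\<^sup>+x\<in>B. ennreal (w x powr s) \<partial>\<mu>)"
        have AQ: "ennpowr (X / ennreal b) (1 / s) * ennreal (b / W) \<le> ennreal Q"
          using Q[OF H(1,2), of z] avgB s b by (simp add: B_def avg_def X_def w_def)
        then have "ennpowr (X / ennreal b) (1 / s) \<noteq> \<infinity>"
          using b W by (auto simp: ennreal_top_mult top_unique split: if_splits)
        then have "X / ennreal b \<noteq> \<infinity>" by (auto simp: ennpowr_def)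
        then have "X \<noteq> \<infinity>" by (auto simp: ennreal_top_divide)
        then obtain Y where Y: "X = ennreal Y" "0 \<le> Y" by (cases X) auto
        have "(Y / b) powr (1 / s) * (b / W) \<le> Q"
          using AQ Y b W Q0 by (simp add: ennpowr_def divide_ennreal ennreal_mult'[symmetric] ennreal_le_iff)
        then have "((Y / b) powr (1 / s) * (b / W)) powr s \<le> Q powr s"
          using b W s by (intro powr_mono2) auto
        also have "((Y / b) powr (1 / s) * (b / W)) powr s = (Y / b) * (b / W) powr s"
        proof -
          have "((Y / b) powr (1 / s) * (b / W)) powr s = ((Y / b) powr (1 / s)) powr s * (b / W) powr s"
            by (rule powr_mult)
          then show ?thesis using b s Y by (simp add: powr_powr)
        qed
        finally have YQ: "Y \<le> Q powr s * b * (W / b) powr s"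
          using b W by (simp add: powr_divide field_simps)
        \<comment> \<open>The mean \<open>W / b\<close> of the weight times a factor that turns
          \<open>c * e\<close> into \<open>(e / b) powr (1 - 1 / s) * W\<close>; the bound for the
          second term is then \<open>Q powr s\<close> times the same quantity.\<close>
        define c where "c = W / b * (b / e) powr (1 / s)"
        have c: "0 < c" using W b e0 by (simp add: c_def)
        have pt: "w x \<le> c + c powr (1 - s) * w x powr s" for x
        proof (cases "w x \<le> c")
          case True
          then show ?thesis by (simp add: add_increasing2)
        next
          case False
          have "w x = w x powr (1 - s) * w x powr s" using w[of x] by (simp add: powr_add[symmetric])
          also have "\<dots> \<le> c powr (1 - s) * w x powr s"
            using False s c by (intro mult_right_mono powr_mono2') auto
          finally show ?thesis using c by linarith
        qed
        have "weight \<mu> \<phi> E t \<le> (\<integral>\<^sup>+x. ennreal c * indicator E x +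
          ennreal (c powr (1 - s)) * (ennreal (w x powr s) * indicator B x) \<partial>\<mu>)"
          unfolding weight_def
        proof (intro nn_integral_mono)
          fix x
          show "ennreal (\<phi> x t) * indicator E x \<le> ennreal c * indicator E x +
            ennreal (c powr (1 - s)) * (ennreal (w x powr s) * indicator B x)"
          proof (cases "x \<in> E")
            case True
            then have "x \<in> B" using H by (auto simp: B_def)
            have "ennreal (w x) \<le> ennreal (c + c powr (1 - s) * w x powr s)"
              using pt by (rule ennreal_leI)
            also have "\<dots> = ennreal c + ennreal (c powr (1 - s)) * ennreal (w x powr s)"
              using c by (simp add: ennreal_plus ennreal_mult'[symmetric])
            finally show ?thesis using True \<open>x \<in> B\<close> by (simp add: w_def)
          qed auto
        qed
        also have "\<dots> = ennreal c * emeasure \<mu> E + ennreal (c powr (1 - s)) * X"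
          by (simp add: nn_integral_add nn_integral_cmult X_def)
        also have "\<dots> = ennreal (c * e + c powr (1 - s) * Y)"
          using e c Y by (simp add: ennreal_plus ennreal_mult'[symmetric])
        also have "c * e + c powr (1 - s) * Y \<le> c * e + c powr (1 - s) * (Q powr s * b * (W / b) powr s)"
          using YQ by (intro add_left_mono mult_left_mono) auto
        also have "c * e = (e / b) powr (1 - 1 / s) * W"
        proof -
          have "(e / b) powr (1 - 1 / s) = e / b * (e / b) powr (- (1 / s))"
            using e0 b by (simp add: powr_diff powr_minus field_simps)
          also have "(e / b) powr (- (1 / s)) = (b / e) powr (1 / s)"
            using e0 b by (simp add: powr_minus powr_divide)
          finally show ?thesis using e0 b by (simp add: c_def)
        qed
        also have "c powr (1 - s) * (Q powr s * b * (W / b) powr s) = Q powr s * ((e / b) powr (1 - 1 / s) * W)"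
        proof -
          have "c powr (1 - s) = (W / b) powr (1 - s) * (b / e) powr (1 / s * (1 - s))"
            unfolding c_def by (simp only: powr_mult powr_powr)
          also have "(b / e) powr (1 / s * (1 - s)) = (e / b) powr (- (1 / s * (1 - s)))"
            using b e0 by (simp add: powr_minus powr_divide)
          also have "- (1 / s * (1 - s)) = 1 - 1 / s" using s by (simp add: field_simps)
          finally have "c powr (1 - s) * (W / b) powr s =
            ((W / b) powr (1 - s) * (W / b) powr s) * (e / b) powr (1 - 1 / s)" by simp
          also have "(W / b) powr (1 - s) * (W / b) powr s = W / b"
            using W b by (simp add: powr_add[symmetric])
          finally have "c powr (1 - s) * (W / b) powr s = W / b * (e / b) powr (1 - 1 / s)" .
          then have "Q powr s * b * (c powr (1 - s) * (W / b) powr s) =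
            Q powr s * b * (W / b * (e / b) powr (1 - 1 / s))" by simp
          then show ?thesis using b by (simp add: mult_ac)
        qed
        also have "(e / b) powr (1 - 1 / s) * W + Q powr s * ((e / b) powr (1 - 1 / s) * W) =
          K * (e / b) powr (1 - 1 / s) * W" using s by (simp add: K_def algebra_simps)
        also have "1 - 1 / s = conj_quot q" using s by (simp add: conj_quot_def diff_divide_distrib)
        finally show ?thesis by (simp add: ennreal_leI)
      qed
      also have "\<dots> = ennreal (K * (e / b) powr conj_quot q) * ennreal W"
        using W \<open>1 \<le> K\<close> by (simp add: ennreal_mult)
      finally show ?thesis using W by (simp add: B_def e_def b_def)
    qed
  qed
qed

lemma weight_decay_0: "weight_decay 0"
  unfolding weight_decay_def
proof (intro exI[of _ 1] conjI allI impI ballI)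
  fix t r :: real and z E
  assume H: "0 < t" "0 < r" "E \<in> sets \<mu>" "E \<subseteq> qball d z r"
  show "weight \<mu> \<phi> E t \<le> ennreal (1 * (measure \<mu> E / measure \<mu> (qball d z r)) powr 0) *
      weight \<mu> \<phi> (qball d z r) t"
  \<comment> \<open>Since \<open>0 powr 0 = 0\<close>, the right side vanishes for null sets, and
    monotonicity alone does not cover them.\<close>
  proof (cases "measure \<mu> E = 0")
    case True
    have "emeasure \<mu> E \<noteq> \<infinity>"
      using H emeasure_mono[OF H(4) qball_sets[OF H(2)]] by (auto simp: emeasure_qball top_unique)
    with True have "emeasure \<mu> E = 0" by (simp add: emeasure_eq_ennreal_measure)
    then show ?thesis using H by (simp add: weight_null)
  next
    case False
    then show ?thesis using weight_mono_set[OF H(4)] H measure_qball_pos[OF H(2), of z]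
      by simp
  qed
qed simp

section \<open>Luxemburg norms of characteristic functions\<close>

lemma Lphi_norm_indicator:
  "Lphi_norm \<mu> \<phi> (indicator E) = Inf {ennreal l | l. 0 < l \<and> weight \<mu> \<phi> E (1 / l) \<le> 1}"
proof -
  have "(\<integral>\<^sup>+x. ennreal (\<phi> x (\<bar>indicator E x\<bar> / l)) \<partial>\<mu>) = weight \<mu> \<phi> E (1 / l)" for l
    unfolding weight_def by (intro nn_integral_cong) (auto simp: indicator_def phi_zero)
  then show ?thesis unfolding Lphi_norm_def by simp
qed

text \<open>Every level \<open>l\<close> admissible for \<open>F\<close> gives the level
  \<open>k * l\<close> admissible for \<open>E\<close>; then infima are taken. All comparisons of
  norms below reduce to such a rescaling of levels.\<close>

lemma Lphi_norm_indicator_le: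
  assumes "0 < k" and H: "\<And>l. \<lbrakk>0 < l; weight \<mu> \<phi> F (1 / l) \<le> 1\<rbrakk> \<Longrightarrow> weight \<mu> \<phi> E (1 / (k * l)) \<le> 1"
  shows "Lphi_norm \<mu> \<phi> (indicator E) \<le> ennreal k * Lphi_norm \<mu> \<phi> (indicator F)"
proof -
  have "Lphi_norm \<mu> \<phi> (indicator E) / ennreal k \<le> Lphi_norm \<mu> \<phi> (indicator F)"
    unfolding Lphi_norm_indicator[of F]
  proof (rule Inf_greatest, clarify)
    fix l :: real assume l: "0 < l" "weight \<mu> \<phi> F (1 / l) \<le> 1"
    have "Lphi_norm \<mu> \<phi> (indicator E) \<le> ennreal (k * l)"
      unfolding Lphi_norm_indicator using H[OF l] l assms(1) by (intro Inf_lower) auto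
    then have "Lphi_norm \<mu> \<phi> (indicator E) / ennreal k \<le> ennreal (k * l) / ennreal k"
      by (rule divide_right_mono_ennreal)
    also have "\<dots> = ennreal l" using l assms(1) by (simp add: divide_ennreal)
    finally show "Lphi_norm \<mu> \<phi> (indicator E) / ennreal k \<le> ennreal l" .
  qed
  then have "ennreal k * (Lphi_norm \<mu> \<phi> (indicator E) / ennreal k) \<le> ennreal k * Lphi_norm \<mu> \<phi> (indicator F)"
    by (rule mult_left_mono) simp
  also have "ennreal k * (Lphi_norm \<mu> \<phi> (indicator E) / ennreal k) = Lphi_norm \<mu> \<phi> (indicator E)"
    unfolding ennreal_times_divide
    by (subst mult.commute, rule mult_divide_eq_ennreal) (use assms(1) in auto)
  finally show ?thesis .
qed

lemma Lphi_norm_mono: "E \<subseteq> F \<Longrightarrow> Lphi_norm \<mu> \<phi> (indicator E) \<le> Lphi_norm \<mu> \<phi> (indicator F)"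
  using Lphi_norm_indicator_le[of 1 F E] weight_mono_set[of E F] by (auto intro: order_trans)

text \<open>The lower type makes the weight of the ball at \<open>1 / l\<close> decay like a power
  of \<open>l\<close>, so a large \<open>l\<close> is admissible. Finiteness is what lets the BMO
  quotient be cleared of its denominator.\<close>

lemma Lphi_norm_qball_finite:
  assumes "0 < r"
  shows "Lphi_norm \<mu> \<phi> (indicator (qball d z r)) < \<infinity>"
proof -
  obtain p C where p: "0 < p" "1 \<le> C"
    "\<And>x t s. \<lbrakk>0 \<le> t; 0 < s; s \<le> 1\<rbrakk> \<Longrightarrow> \<phi> x (s * t) \<le> C * s powr p * \<phi> x t"
    using lower_type_obtain by metis
  obtain w where w: "0 < w" "weight \<mu> \<phi> (qball d z r) 1 = ennreal w"
    using weight_qball_obtain[OF zero_less_one assms] by metis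
  define l where "l = max 1 ((C * w) powr (1 / p))"
  have l: "1 \<le> l" "(C * w) powr (1 / p) \<le> l" by (auto simp: l_def)
  have "C * w = ((C * w) powr (1 / p)) powr p" using p w by (simp add: powr_powr)
  also have "\<dots> \<le> l powr p" using l p by (intro powr_mono2) auto
  finally have Cw: "C * w \<le> l powr p" .
  have "weight \<mu> \<phi> (qball d z r) (1 / l) \<le> ennreal (C * (1 / l) powr p) * weight \<mu> \<phi> (qball d z r) 1"
    using p(2) p(3)[of 1 "1 / l"] l assms by (intro weight_le_scale) (auto simp: qball_sets)
  also have "\<dots> = ennreal (C * w / l powr p)"
    using w l p by (simp add: ennreal_mult'[symmetric] powr_divide)
  also have "\<dots> \<le> 1" using Cw l by (simp add: ennreal_le_1)
  finally have "Lphi_norm \<mu> \<phi> (indicator (qball d z r)) \<le> ennreal l"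
    unfolding Lphi_norm_indicator using l by (intro Inf_lower) auto
  then show ?thesis by (simp add: le_less_trans)
qed

text \<open>Dilation multiplies the weight by at most a constant, and the lower type compensates for
  a constant factor by a fixed rescaling of the level.\<close>

lemma Lphi_norm_doubling:
  obtains C where "1 \<le> C" "\<And>z r. 0 < r \<Longrightarrow>
    Lphi_norm \<mu> \<phi> (indicator (qball d z (L * r))) \<le> ennreal C * Lphi_norm \<mu> \<phi> (indicator (qball d z r))"
proof -
  obtain K q where K: "1 \<le> K" "1 \<le> q"
    "\<And>t z r E l. \<lbrakk>0 < t; 0 < r; E \<in> sets \<mu>; E \<subseteq> qball d z r; 0 < measure \<mu> E; 1 \<le> l;
        measure \<mu> (qball d z r) \<le> l * measure \<mu> E\<rbrakk> \<Longrightarrow>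
      weight \<mu> \<phi> (qball d z r) t < \<infinity> \<and>
      weight \<mu> \<phi> (qball d z r) t \<le> ennreal (K * l powr q) * weight \<mu> \<phi> E t"
    using weight_doubling by metis
  obtain p C where p: "0 < p" "1 \<le> C"
    "\<And>x t s. \<lbrakk>0 \<le> t; 0 < s; s \<le> 1\<rbrakk> \<Longrightarrow> \<phi> x (s * t) \<le> C * s powr p * \<phi> x t"
    using lower_type_obtain by metis
  obtain n where "cond_D d \<mu> n" using cond_D_exists by blast
  from cond_D_obtain[OF this] obtain D where D: "1 \<le> D" "0 < n" "\<And>x r l. \<lbrakk>0 < r; 1 \<le> l\<rbrakk> \<Longrightarrow>
    measure \<mu> (qball d x (l * r)) \<le> D * l powr n * measure \<mu> (qball d x r)"
    by metis
  \<comment> \<open>\<open>L\<close> is arbitrary; with \<open>L' \<ge> 1\<close> the dilated ball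
    contains the original one.\<close>
  define L' where "L' = max 1 L"
  define J where "J = C * (K * (D * L' powr n) powr q)"
  \<comment> \<open>Chosen so that the accumulated constant \<open>J\<close> is cancelled by
    \<open>k powr p\<close>.\<close>
  define k where "k = J powr (1 / p)"
  have L': "1 \<le> D * L' powr n"
    using D(1) mult_mono[OF D(1) ge_one_powr_ge_zero[of L' n]] D(2) by (simp add: L'_def)
  then have "1 \<le> K * (D * L' powr n) powr q"
    using K(1) mult_mono[OF K(1) ge_one_powr_ge_zero[OF L', of q]] K(2) by simp
  then have J: "1 \<le> J" using p(2) mult_mono[OF p(2)] unfolding J_def by fastforce
  have k: "1 \<le> k" "k powr p = J"
    using J p by (auto simp: k_def powr_powr intro: ge_one_powr_ge_zero)
  show thesis
  proof (rule that[of k])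
    fix z and r :: real assume r: "0 < r"
    let ?B = "qball d z r" and ?B' = "qball d z (L' * r)"
    have "r \<le> L' * r" using r mult_right_mono[of 1 L' r] by (simp add: L'_def)
    then have sub: "?B \<subseteq> ?B'" by (rule qball_mono)
    have r': "0 < L' * r" using r by (simp add: L'_def)
    have "Lphi_norm \<mu> \<phi> (indicator ?B') \<le> ennreal k * Lphi_norm \<mu> \<phi> (indicator ?B)"
    proof (rule Lphi_norm_indicator_le)
      fix l :: real assume l: "0 < l" "weight \<mu> \<phi> ?B (1 / l) \<le> 1"
      have "weight \<mu> \<phi> ?B' (1 / l) \<le> ennreal (K * (D * L' powr n) powr q) * weight \<mu> \<phi> ?B (1 / l)"
        using K(3)[of "1 / l" "L' * r" ?B z "D * L' powr n"] l r r' sub L' D(3)[of r L' z]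
        by (simp add: qball_sets measure_qball_pos L'_def)
      also have "\<dots> \<le> ennreal (K * (D * L' powr n) powr q) * 1"
        using l(2) by (rule mult_left_mono) simp
      finally have B': "weight \<mu> \<phi> ?B' (1 / l) \<le> ennreal (K * (D * L' powr n) powr q)" by simp
      have "weight \<mu> \<phi> ?B' (1 / (k * l)) \<le> ennreal (C * (1 / k) powr p) * weight \<mu> \<phi> ?B' (1 / l)"
        using p(2) p(3)[of "1 / l" "1 / k"] l k r' by (intro weight_le_scale) (auto simp: qball_sets)
      also have "\<dots> \<le> ennreal (C * (1 / k) powr p) * ennreal (K * (D * L' powr n) powr q)"
        using B' by (rule mult_left_mono) simp
      also have "\<dots> = ennreal (J / k powr p)"
        using p(2) k K by (simp add: ennreal_mult'[symmetric] powr_divide J_def)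
      also have "\<dots> = 1" using k J by simp
      finally show "weight \<mu> \<phi> ?B' (1 / (k * l)) \<le> 1" .
    qed (use k in simp)
    moreover have "Lphi_norm \<mu> \<phi> (indicator (qball d z (L * r))) \<le> Lphi_norm \<mu> \<phi> (indicator ?B')"
      using r by (intro Lphi_norm_mono qball_mono) (simp add: L'_def)
    ultimately show "Lphi_norm \<mu> \<phi> (indicator (qball d z (L * r))) \<le>
      ennreal k * Lphi_norm \<mu> \<phi> (indicator ?B)" by (rule order_trans[rotated])
  qed (rule k)
qed

text \<open>Upper type \<open>1\<close> turns a factor gained in the weight linearly into one gained
  in the level, so the exponent \<open>\<theta>\<close> passes from weights to norms without
  loss.\<close>

lemma Lphi_norm_decay:
  assumes "weight_decay \<theta>"
  obtains C where "1 \<le> C" "\<And>z r x s. \<lbrakk>0 < r; 0 < s; qball d x s \<subseteq> qball d z r\<rbrakk> \<Longrightarrow>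
    Lphi_norm \<mu> \<phi> (indicator (qball d x s)) \<le>
      ennreal (C * (measure \<mu> (qball d x s) / measure \<mu> (qball d z r)) powr \<theta>) *
      Lphi_norm \<mu> \<phi> (indicator (qball d z r))"
proof -
  obtain K where K: "1 \<le> K" "\<And>t z r E. \<lbrakk>0 < t; 0 < r; E \<in> sets \<mu>; E \<subseteq> qball d z r\<rbrakk> \<Longrightarrow>
     weight \<mu> \<phi> E t \<le>
       ennreal (K * (measure \<mu> E / measure \<mu> (qball d z r)) powr \<theta>) * weight \<mu> \<phi> (qball d z r) t"
    using assms unfolding weight_decay_def by blast
  obtain C where C: "1 \<le> C" "\<And>x t s. \<lbrakk>0 \<le> t; 1 \<le> s\<rbrakk> \<Longrightarrow> \<phi> x (s * t) \<le> C * s * \<phi> x t"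
    using upper_type_obtain by metis
  have CK: "1 \<le> C * K" using mult_mono[OF C(1) K(1)] C(1) by simp
  show thesis
  proof (rule that[OF CK])
    fix z x and r s :: real assume H: "0 < r" "0 < s" "qball d x s \<subseteq> qball d z r"
    let ?E = "qball d x s" and ?B = "qball d z r"
    define \<epsilon> where "\<epsilon> = (measure \<mu> ?E / measure \<mu> ?B) powr \<theta>"
    have eps: "0 < \<epsilon>" using measure_qball_pos[of _ x] measure_qball_pos[of _ z] H
      by (simp add: \<epsilon>_def less_imp_neq[symmetric])
    define k where "k = C * K * \<epsilon>"
    have k: "0 < k" using CK eps by (simp add: k_def)
    have "Lphi_norm \<mu> \<phi> (indicator ?E) \<le> ennreal k * Lphi_norm \<mu> \<phi> (indicator ?B)"
    proof (rule Lphi_norm_indicator_le[OF k])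
      fix l :: real assume l: "0 < l" "weight \<mu> \<phi> ?B (1 / l) \<le> 1"
      show "weight \<mu> \<phi> ?E (1 / (k * l)) \<le> 1"
      \<comment> \<open>The upper type is applied with \<open>s = 1 / k\<close>, which must be at
        least \<open>1\<close>; there \<open>C / k\<close> cancels the gain
        \<open>K * \<epsilon>\<close>. For \<open>k > 1\<close> the level only grows and
        monotonicity of \<open>\<phi>\<close> is enough.\<close>
      proof (cases "k \<le> 1")
        case True
        have "weight \<mu> \<phi> ?E (1 / l) \<le> ennreal (K * \<epsilon>) * weight \<mu> \<phi> ?B (1 / l)"
          unfolding \<epsilon>_def using H l by (intro K) (auto simp: qball_sets)
        also have "\<dots> \<le> ennreal (K * \<epsilon>) * 1" using l(2) by (rule mult_left_mono) simp
        finally have E: "weight \<mu> \<phi> ?E (1 / l) \<le> ennreal (K * \<epsilon>)" by simp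
        have "weight \<mu> \<phi> ?E (1 / (k * l)) \<le> ennreal (C * (1 / k)) * weight \<mu> \<phi> ?E (1 / l)"
          using C(1) C(2)[of "1 / l" "1 / k"] l k True H
          by (intro weight_le_scale) (auto simp: qball_sets)
        also have "\<dots> \<le> ennreal (C * (1 / k)) * ennreal (K * \<epsilon>)" using E by (rule mult_left_mono) simp
        also have "\<dots> = ennreal (k / k)" using C(1) K(1) k eps
          by (simp add: ennreal_mult'[symmetric] k_def mult_ac)
        also have "\<dots> = 1" using k by simp
        finally show ?thesis .
      next
        case False
        have "weight \<mu> \<phi> ?E (1 / (k * l)) \<le> weight \<mu> \<phi> ?B (1 / (k * l))"
          using H(3) by (rule weight_mono_set)
        also have "\<dots> \<le> ennreal 1 * weight \<mu> \<phi> ?B (1 / l)"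
          using False l H by (intro weight_le_scale) (auto simp: qball_sets intro!: phi_mono divide_left_mono)
        finally show ?thesis using l(2) by simp
      qed
    qed
    then show "Lphi_norm \<mu> \<phi> (indicator ?E) \<le>
      ennreal (C * K * (measure \<mu> ?E / measure \<mu> ?B) powr \<theta>) * Lphi_norm \<mu> \<phi> (indicator ?B)"
      by (simp add: k_def \<epsilon>_def)
  qed
qed

text \<open>The local bounds are summed over a covering by balls of radius \<open>r\<close>, with
  \<open>sum_powr_le\<close> controlling the powers of the volume ratios. The radii
  \<open>2 * R\<close> and \<open>R\<close> differ because a dyadic annulus lies in the larger ball,
  while its denominator is bounded below by the norm of the smaller one.\<close>

lemma integral_qball_le:
  assumes "cond_D d \<mu> n" "weight_decay \<theta>" "0 \<le> \<theta>" "\<theta> \<le> 1"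
  obtains C where "1 \<le> C"
    "\<And>x0 r R h N. \<lbrakk>0 < r; r \<le> R; h \<in> borel_measurable \<mu>;
       \<And>z. (\<integral>\<^sup>+x\<in>qball d z r. h x \<partial>\<mu>) \<le> N * Lphi_norm \<mu> \<phi> (indicator (qball d z r))\<rbrakk> \<Longrightarrow>
     (\<integral>\<^sup>+x\<in>qball d x0 (2 * R). h x \<partial>\<mu>) \<le>
       ennreal (C * (R / r) powr (n * (1 - \<theta>))) * N * Lphi_norm \<mu> \<phi> (indicator (qball d x0 R))"
proof -
  obtain L K where LK: "1 \<le> L" "1 \<le> K"
    "\<And>x0 r R. \<lbrakk>0 < r; r \<le> R\<rbrakk> \<Longrightarrow> \<exists>F. finite F \<and> real (card F) \<le> K * (R / r) powr n \<and>
       qball d x0 R \<subseteq> (\<Union>x\<in>F. qball d x r) \<and> (\<forall>x\<in>F. qball d x r \<subseteq> qball d x0 (L * R)) \<and>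
       (\<Sum>x\<in>F. measure \<mu> (qball d x r)) \<le> K * measure \<mu> (qball d x0 (L * R))"
    using covering[OF assms(1)] by metis
  obtain D where D: "1 \<le> D" "\<And>z r. 0 < r \<Longrightarrow>
    Lphi_norm \<mu> \<phi> (indicator (qball d z (2 * L * r))) \<le> ennreal D * Lphi_norm \<mu> \<phi> (indicator (qball d z r))"
    using Lphi_norm_doubling by metis
  obtain E where E: "1 \<le> E" "\<And>z r x s. \<lbrakk>0 < r; 0 < s; qball d x s \<subseteq> qball d z r\<rbrakk> \<Longrightarrow>
    Lphi_norm \<mu> \<phi> (indicator (qball d x s)) \<le>
      ennreal (E * (measure \<mu> (qball d x s) / measure \<mu> (qball d z r)) powr \<theta>) *
      Lphi_norm \<mu> \<phi> (indicator (qball d z r))"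
    using Lphi_norm_decay[OF assms(2)] by metis
  have n: "0 < n" using assms(1) by (simp add: cond_D_def)
  \<comment> \<open>\<open>E\<close> comes from the decay of norms, the middle factor from
    \<open>sum_powr_le\<close> with at most \<open>K * (2 * R / r) powr n\<close> balls, and
    \<open>D\<close> from shrinking radius \<open>2 * L * R\<close> to \<open>R\<close>.\<close>
  define C where "C = E * ((1 + K) * (K * 2 powr n) powr (1 - \<theta>)) * D"
  have "1 \<le> K * 2 powr n"
    using LK(2) n mult_mono[OF LK(2) ge_one_powr_ge_zero[of 2 n]] by simp
  then have "1 \<le> (K * 2 powr n) powr (1 - \<theta>)" using assms(4) by (intro ge_one_powr_ge_zero) auto
  then have "1 * 1 \<le> (1 + K) * (K * 2 powr n) powr (1 - \<theta>)" using LK(2) by (intro mult_mono) auto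
  then have "1 * 1 * 1 \<le> C" unfolding C_def using D(1) E(1) by (intro mult_mono) auto
  then have C: "1 \<le> C" by simp
  show thesis
  proof (rule that[OF C])
    fix x0 and r R :: real and h :: "'a \<Rightarrow> ennreal" and N :: ennreal
    assume r: "0 < r" "r \<le> R" and [measurable]: "h \<in> borel_measurable \<mu>"
      and N: "\<And>z. (\<integral>\<^sup>+x\<in>qball d z r. h x \<partial>\<mu>) \<le> N * Lphi_norm \<mu> \<phi> (indicator (qball d z r))"
    let ?B = "qball d x0 (L * (2 * R))"
    obtain F where F: "finite F" "real (card F) \<le> K * (2 * R / r) powr n"
       "qball d x0 (2 * R) \<subseteq> (\<Union>x\<in>F. qball d x r)" "\<And>x. x \<in> F \<Longrightarrow> qball d x r \<subseteq> ?B"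
       "(\<Sum>x\<in>F. measure \<mu> (qball d x r)) \<le> K * measure \<mu> ?B"
      using LK(3)[of r "2 * R" x0] r by auto
    have LR: "0 < L * (2 * R)" using LK(1) r by simp
    note [measurable] = qball_sets[OF r(1)]
    define u where "u x = measure \<mu> (qball d x r) / measure \<mu> ?B" for x
    have u: "0 < u x" for x unfolding u_def using r LR by (simp add: measure_qball_pos)
    have "1 \<le> 2 * R / r" using r by simp
    then have "1 \<le> (2 * R / r) powr n" using n by (intro ge_one_powr_ge_zero) auto
    then have P: "1 \<le> K * (2 * R / r) powr n" using LK(2) mult_mono[of 1 K 1 "(2 * R / r) powr n"] by simp
    have "(\<Sum>x\<in>F. u x powr \<theta>) \<le> (1 + K) * (K * (2 * R / r) powr n) powr (1 - \<theta>)"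
    proof (rule sum_powr_le[OF F(1) assms(3,4) F(2) P u])
      show "sum u F \<le> K" using F(5) measure_qball_pos[OF LR, of x0]
        by (simp add: u_def sum_divide_distrib[symmetric] divide_le_eq)
    qed
    also have "K * (2 * R / r) powr n = K * 2 powr n * (R / r) powr n"
      using powr_mult[of 2 "R / r" n] by simp
    also have "(K * 2 powr n * (R / r) powr n) powr (1 - \<theta>) =
      (K * 2 powr n) powr (1 - \<theta>) * (R / r) powr (n * (1 - \<theta>))"
      by (simp only: powr_mult powr_powr)
    finally have S: "E * (\<Sum>x\<in>F. u x powr \<theta>) * D \<le> C * (R / r) powr (n * (1 - \<theta>))"
      unfolding C_def using E(1) D(1) by (simp add: mult_ac)
    have "(\<integral>\<^sup>+x\<in>qball d x0 (2 * R). h x \<partial>\<mu>) \<le> (\<integral>\<^sup>+x. (\<Sum>z\<in>F. h x * indicator (qball d z r) x) \<partial>\<mu>)"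
    proof (intro nn_integral_mono)
      fix x
      show "h x * indicator (qball d x0 (2 * R)) x \<le> (\<Sum>z\<in>F. h x * indicator (qball d z r) x)"
      proof (cases "x \<in> qball d x0 (2 * R)")
        case True
        then obtain z where z: "z \<in> F" "x \<in> qball d z r" using F(3) by blast
        have "h x * indicator (qball d z r) x \<le> (\<Sum>z\<in>F. h x * indicator (qball d z r) x)"
          using F(1) z(1) by (intro member_le_sum) auto
        then show ?thesis using z True by simp
      qed auto
    qed
    also have "\<dots> = (\<Sum>z\<in>F. \<integral>\<^sup>+x\<in>qball d z r. h x \<partial>\<mu>)" by (rule nn_integral_sum) measurable
    also have "\<dots> \<le> (\<Sum>z\<in>F. N * (ennreal (E * u z powr \<theta>) * Lphi_norm \<mu> \<phi> (indicator ?B)))"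
    proof (intro sum_mono)
      fix z assume "z \<in> F"
      have "N * Lphi_norm \<mu> \<phi> (indicator (qball d z r)) \<le>
        N * (ennreal (E * u z powr \<theta>) * Lphi_norm \<mu> \<phi> (indicator ?B))"
        unfolding u_def by (rule mult_left_mono[OF E(2)[OF LR r(1) F(4)[OF \<open>z \<in> F\<close>]]]) simp
      with N[of z] show "(\<integral>\<^sup>+x\<in>qball d z r. h x \<partial>\<mu>) \<le>
        N * (ennreal (E * u z powr \<theta>) * Lphi_norm \<mu> \<phi> (indicator ?B))" by (rule order_trans)
    qed
    also have "\<dots> = (\<Sum>z\<in>F. ennreal (E * u z powr \<theta>)) * (N * Lphi_norm \<mu> \<phi> (indicator ?B))"
      unfolding sum_distrib_right by (intro sum.cong refl) (simp add: mult_ac)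
    also have "(\<Sum>z\<in>F. ennreal (E * u z powr \<theta>)) = ennreal (E * (\<Sum>x\<in>F. u x powr \<theta>))"
      using E(1) by (simp add: sum_ennreal sum_distrib_left)
    also have "\<dots> * (N * Lphi_norm \<mu> \<phi> (indicator ?B)) \<le>
      \<dots> * (N * (ennreal D * Lphi_norm \<mu> \<phi> (indicator (qball d x0 R))))"
      using D(2)[of R x0] r by (intro mult_left_mono) (auto simp: mult_ac)
    also have "\<dots> = ennreal (E * (\<Sum>x\<in>F. u x powr \<theta>) * D) * N * Lphi_norm \<mu> \<phi> (indicator (qball d x0 R))"
    proof -
      have "ennreal (E * (\<Sum>x\<in>F. u x powr \<theta>) * D) = ennreal (E * (\<Sum>x\<in>F. u x powr \<theta>)) * ennreal D"
        using D(1) by (intro ennreal_mult'') auto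
      then show ?thesis by (simp only: mult_ac)
    qed
    also have "\<dots> \<le> ennreal (C * (R / r) powr (n * (1 - \<theta>))) * N * Lphi_norm \<mu> \<phi> (indicator (qball d x0 R))"
      using S by (intro mult_right_mono ennreal_leI) auto
    finally show "(\<integral>\<^sup>+x\<in>qball d x0 (2 * R). h x \<partial>\<mu>) \<le>
       ennreal (C * (R / r) powr (n * (1 - \<theta>))) * N * Lphi_norm \<mu> \<phi> (indicator (qball d x0 R))" .
  qed
qed

section \<open>Indices\<close>

text \<open>Going from \<open>1\<close> down to \<open>s\<close> by the lower type and back up by
  the upper type \<open>1\<close> costs a factor \<open>U * C * s powr (p - 1)\<close>, which for
  \<open>p > 1\<close> would be below \<open>1\<close> at small \<open>s\<close>.\<close>

lemma lower_type_le_1: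
  assumes "lower_type \<phi> p"
  shows "p \<le> 1"
proof (rule ccontr)
  assume p: "\<not> p \<le> 1"
  obtain C where C: "\<And>x t s. \<lbrakk>0 \<le> t; 0 < s; s < 1\<rbrakk> \<Longrightarrow> \<phi> x (s * t) \<le> C * s powr p * \<phi> x t"
    using assms unfolding lower_type_def by blast
  obtain U where U: "1 \<le> U" "\<And>x t s. \<lbrakk>0 \<le> t; 1 \<le> s\<rbrakk> \<Longrightarrow> \<phi> x (s * t) \<le> U * s * \<phi> x t"
    using upper_type_obtain by metis
  \<comment> \<open>\<open>D\<close> exceeds \<open>U * C\<close> whatever the sign of
    \<open>C\<close>, and \<open>s\<close> is then chosen to satisfy
    \<open>s powr (p - 1) = 1 / D\<close>.\<close>
  define D where "D = 2 * (1 + \<bar>U * C\<bar>)"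
  define s where "s = (1 / D) powr (1 / (p - 1))"
  have D: "2 \<le> D" "U * C < D" by (auto simp: D_def)
  have "1 < D powr (1 / (p - 1))" using D p by (intro gr_one_powr) auto
  then have s: "0 < s" "s < 1" using D by (auto simp: s_def powr_divide)
  have sp: "s powr (p - 1) = 1 / D" using D p by (simp add: s_def powr_powr)
  fix x :: 'a
  have "\<phi> x 1 \<le> U * (1 / s) * \<phi> x s" using U(2)[of s "1 / s" x] s by simp
  also have "\<dots> \<le> U * (1 / s) * (C * s powr p * \<phi> x 1)"
    using C[of 1 s x] s U(1) by (intro mult_left_mono) auto
  also have "\<dots> = U * C * s powr (p - 1) * \<phi> x 1" using s by (simp add: powr_diff)
  also have "\<dots> < 1 * \<phi> x 1" unfolding sp
    using D phi_pos[of 1 x] by (intro mult_strict_right_mono) (auto simp: divide_less_eq)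
  finally show False by simp
qed

text \<open>Boundedness by \<open>1\<close> also makes the \<open>Sup\<close> in
  \<open>index_i\<close> a genuine supremum, which the proof of positivity uses.\<close>

lemma index_i_bounds: "0 < index_i \<phi>" "index_i \<phi> \<le> 1"
proof -
  obtain p where p: "0 < p" "lower_type \<phi> p"
    using growth_function unfolding growth_function_def by blast
  have "p \<le> index_i \<phi>" unfolding index_i_def
    using p lower_type_le_1 by (intro cSup_upper bdd_aboveI[of _ 1]) auto
  with p show "0 < index_i \<phi>" by simp
  show "index_i \<phi> \<le> 1" unfolding index_i_def
    using p lower_type_le_1 by (intro cSup_least) auto
qed

lemma index_p_ge_1: "1 \<le> index_p d \<mu> \<phi>"
  unfolding index_p_def using growth_function
  by (intro cInf_greatest) (auto simp: growth_function_def)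

text \<open>If \<open>\<phi>\<close> lies in no reverse Hoelder class, then \<open>index_r\<close> is \<open>-\<infinity>\<close> and \<open>conj_quot\<close>
  evaluates to the junk value \<open>0\<close>, for which the trivial exponent \<open>\<theta> = 0\<close> suffices.\<close>

lemma exponent_obtain:
  assumes "deg_n d \<mu> * (1 - conj_quot (index_r d \<mu> \<phi>)) < \<delta>"
  obtains n \<theta> where "cond_D d \<mu> n" "weight_decay \<theta>" "0 \<le> \<theta>" "\<theta> \<le> 1" "n * (1 - \<theta>) < \<delta>"
proof -
  let ?S = "{q. 1 < q \<and> RH_class d \<mu> q \<phi>}"
  have n_less: "\<exists>n. cond_D d \<mu> n \<and> n < y" if "deg_n d \<mu> < y" for y
    using that cInf_lessD[of "{n. cond_D d \<mu> n}" y] cond_D_exists unfolding deg_n_def by auto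
  show thesis
  proof (cases "?S = {}")
    case True
    then have "index_r d \<mu> \<phi> = - \<infinity>" unfolding index_r_def True by (simp add: bot_ereal_def)
    then have "deg_n d \<mu> < \<delta>" using assms by (simp add: conj_quot_def)
    then obtain n where "cond_D d \<mu> n" "n < \<delta>" using n_less by blast
    with that[of n 0] weight_decay_0 show thesis by simp
  next
    case False
    define R where "R = index_r d \<mu> \<phi>"
    have R: "1 < R" using False unfolding R_def index_r_def
      by (auto intro: less_le_trans Sup_upper)
    have quot: "1 - conj_quot q = (if q = \<infinity> then 0 else 1 / real_of_ereal q)" if "1 < q" for q
      using that by (cases q) (auto simp: conj_quot_def diff_divide_distrib)
    have quot01: "0 \<le> conj_quot q" "conj_quot q \<le> 1" if "1 < q" for q
      using that by (cases q; simp add: conj_quot_def)+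
    have "0 \<le> deg_n d \<mu> * (1 - conj_quot R)"
      using deg_n_nonneg quot01[OF R] by simp
    then have \<delta>: "0 < \<delta>" using assms by (simp add: R_def)
    \<comment> \<open>For finite \<open>q\<close> the target
      \<open>n * (1 - conj_quot q) < \<delta>\<close> reads \<open>n / \<delta> < q\<close>. Written
      with extended reals, this strict inequality also covers \<open>R = \<infinity>\<close> and
      descends from the supremum \<open>R\<close> to some admissible \<open>q\<close>.\<close>
    have "\<exists>n. cond_D d \<mu> n \<and> ereal (n / \<delta>) < R"
    proof (cases R)
      case (real \<rho>)
      then have "deg_n d \<mu> * (1 / \<rho>) < \<delta>" "1 < \<rho>"
        using assms R quot[OF R] unfolding R_def[symmetric] by simp_all
      then have "deg_n d \<mu> < \<delta> * \<rho>" by (simp add: field_simps)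
      then obtain n where "cond_D d \<mu> n" "n < \<delta> * \<rho>" using n_less by blast
      then show ?thesis using real \<delta> by (auto simp: field_simps)
    qed (use cond_D_exists R in auto)
    then obtain n where n: "cond_D d \<mu> n" "ereal (n / \<delta>) < R" by blast
    then obtain q where q: "1 < q" "RH_class d \<mu> q \<phi>" "ereal (n / \<delta>) < q"
      unfolding R_def index_r_def less_Sup_iff by blast
    have "n * (1 - conj_quot q) < \<delta>"
      using q \<delta> by (cases q) (auto simp: quot field_simps)
    with n(1) q quot01[OF q(1)] show thesis
      by (intro that[of n "conj_quot q"] RH_class_imp_weight_decay)
  qed
qed

end

section \<open>Summation over dyadic annuli\<close>

theorem proposition3p9:
  fixes d :: "'a \<Rightarrow> 'a \<Rightarrow> real" and \<mu> :: "'a measure"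
    and \<phi> :: "'a \<Rightarrow> real \<Rightarrow> real"
    and m M \<delta> :: real and g :: "real \<Rightarrow> real"
    and a :: "real \<Rightarrow> 'a \<Rightarrow> 'a \<Rightarrow> complex"
  assumes "homogeneous_type d \<mu>"
    and "growth_function d \<mu> \<phi>"
    and "0 < m"
    and "M > deg_n d \<mu> * (1 + index_p d \<mu> \<phi> / index_i \<phi>) - deg_alpha d \<mu>"
    and "assumption_SP d \<mu> \<phi> m M g a"
    and "\<delta> > deg_n d \<mu> + deg_N d \<mu>
           + 1 / m * (deg_n d \<mu> * index_p d \<mu> \<phi> / index_i \<phi> - deg_alpha d \<mu>)
           - deg_n d \<mu> * conj_quot (index_r d \<mu> \<phi>)"
  shows "\<exists>C>0. \<forall>x0. \<forall>f\<in>BMO d \<mu> \<phi> m M a. \<forall>t>0.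
           (\<integral>\<^sup>+x. ennreal (cmod (f x - A_op \<mu> a t f x)) /
               (ennreal ((t powr (1 / m) + d x0 x) powr \<delta>) *
                Lphi_norm \<mu> \<phi> (indicator (qball d x0 (t powr (1 / m) + d x0 x)))) \<partial>\<mu>)
           \<le> ennreal (C / t powr (\<delta> / m)) * BMO_norm d \<mu> \<phi> m a f"
proof -
  interpret growth d \<mu> \<phi> by unfold_locales (fact assms)+
  have "1 \<le> index_p d \<mu> \<phi> / index_i \<phi>"
    using index_i_bounds index_p_ge_1 by (simp add: le_divide_eq)
  then have "deg_n d \<mu> * 1 \<le> deg_n d \<mu> * (index_p d \<mu> \<phi> / index_i \<phi>)"
    using deg_n_nonneg by (rule mult_left_mono)
  then have "0 \<le> 1 / m * (deg_n d \<mu> * index_p d \<mu> \<phi> / index_i \<phi> - deg_alpha d \<mu>)"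
    using deg_alpha_le_deg_n assms(3) by simp
  then have "deg_n d \<mu> * (1 - conj_quot (index_r d \<mu> \<phi>)) < \<delta>"
    using assms(6) deg_N_nonneg by (simp add: right_diff_distrib)
  then obtain n \<theta> where n: "cond_D d \<mu> n" "weight_decay \<theta>" "0 \<le> \<theta>" "\<theta> \<le> 1" "n * (1 - \<theta>) < \<delta>"
    by (rule exponent_obtain)
  obtain C where C: "1 \<le> C"
    "\<And>x0 r R h N. \<lbrakk>0 < r; r \<le> R; h \<in> borel_measurable \<mu>;
       \<And>z. (\<integral>\<^sup>+x\<in>qball d z r. h x \<partial>\<mu>) \<le> N * Lphi_norm \<mu> \<phi> (indicator (qball d z r))\<rbrakk> \<Longrightarrow>
     (\<integral>\<^sup>+x\<in>qball d x0 (2 * R). h x \<partial>\<mu>) \<le>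
       ennreal (C * (R / r) powr (n * (1 - \<theta>))) * N * Lphi_norm \<mu> \<phi> (indicator (qball d x0 R))"
    using integral_qball_le[OF n(1-4)] by blast
  define \<gamma> where "\<gamma> = n * (1 - \<theta>)"
  have "0 < n" using n(1) by (simp add: cond_D_def)
  then have "0 \<le> \<gamma>" using n(4) by (simp add: \<gamma>_def)
  then have \<delta>: "0 < \<delta>" "\<gamma> < \<delta>" using n(5) by (auto simp: \<gamma>_def)
  \<comment> \<open>The ratio of the geometric series over the annuli: \<open>\<gamma>\<close>
    measures the growth from the covering, \<open>\<delta>\<close> the decay of the
    denominator.\<close>
  define \<rho> :: real where "\<rho> = 2 powr (\<gamma> - \<delta>)"
  have \<rho>: "0 < \<rho>" "\<rho> < 1" using powr_less_mono[of "\<gamma> - \<delta>" 0 2] \<delta> by (auto simp: \<rho>_def)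
  show ?thesis
  proof (intro exI[of _ "C / (1 - \<rho>)"] conjI allI ballI impI)
    show "0 < C / (1 - \<rho>)" using C(1) \<rho> by simp
    fix x0 f and t :: real
    assume f: "f \<in> BMO d \<mu> \<phi> m M a" and t: "0 < t"
    define N where "N = BMO_norm d \<mu> \<phi> m a f"
    define r where "r = t powr (1 / m)"
    have r: "0 < r" using t by (simp add: r_def)
    \<comment> \<open>For balls of radius \<open>r\<close> the operator in the BMO norm is exactly
      \<open>A_op \<mu> a t\<close>, whatever the centre, so one function \<open>h\<close> serves
      for the whole covering.\<close>
    have rm: "r powr m = t" using t assms(3) by (simp add: r_def powr_powr)
    have N: "N < \<infinity>" and fm [measurable]: "f \<in> borel_measurable \<mu>"
      using f by (auto simp: BMO_def N_def M_space_def M_at_def L1_loc_def)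
    have [measurable]: "A_op \<mu> a t f \<in> borel_measurable \<mu>"
      using assms(5) t by (intro borel_measurable_A_op fm)
        (auto simp: assumption_SP_def gen_approx_identity_def)
    define h where "h x = ennreal (cmod (f x - A_op \<mu> a t f x))" for x
    have h [measurable]: "h \<in> borel_measurable \<mu>" unfolding h_def[abs_def] by measurable
    have hN: "(\<integral>\<^sup>+x\<in>qball d z r. h x \<partial>\<mu>) \<le> N * Lphi_norm \<mu> \<phi> (indicator (qball d z r))" for z
    proof (rule ennreal_le_mult_of_divide_le[OF _ Lphi_norm_qball_finite[OF r] N])
      show "(\<integral>\<^sup>+x\<in>qball d z r. h x \<partial>\<mu>) / Lphi_norm \<mu> \<phi> (indicator (qball d z r)) \<le> N"
        unfolding N_def BMO_norm_def h_def using r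
        by (intro SUP_upper2[of z UNIV, OF UNIV_I] SUP_upper2[of r "{0<..}"]) (auto simp: rm)
    qed
    define b where "b k = Lphi_norm \<mu> \<phi> (indicator (qball d x0 (2 ^ k * r)))" for k :: nat
    \<comment> \<open>The reciprocal of a lower bound for the denominator on the \<open>k\<close>-th
      annulus.\<close>
    define c where "c k = inverse (ennreal ((2 ^ k * r) powr \<delta>) * b k)" for k :: nat
    define B where "B k = qball d x0 (2 * (2 ^ k * r))" for k :: nat
    have [measurable]: "B k \<in> sets \<mu>" for k using r by (simp add: B_def qball_sets)
    \<comment> \<open>Each annulus is enlarged to the ball \<open>B k\<close>; the resulting
      multiple counting is harmless for an upper bound.\<close>
    have "(\<integral>\<^sup>+x. h x / (ennreal ((r + d x0 x) powr \<delta>) *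
        Lphi_norm \<mu> \<phi> (indicator (qball d x0 (r + d x0 x)))) \<partial>\<mu>)
      \<le> (\<integral>\<^sup>+x. (\<Sum>k. c k * (h x * indicator (B k) x)) \<partial>\<mu>)"
    proof (intro nn_integral_mono)
      fix x
      have "1 \<le> (r + d x0 x) / r" using r by simp
      then obtain k where "2 ^ k \<le> (r + d x0 x) / r" "(r + d x0 x) / r < 2 ^ Suc k"
        by (rule dyadic_obtain)
      then have k: "2 ^ k * r \<le> r + d x0 x" "r + d x0 x < 2 * (2 ^ k * r)"
        using r by (auto simp: field_simps)
      have "x \<in> B k" using k(2) r by (simp add: B_def qball_def d_commute[of x])
      have "(2 ^ k * r) powr \<delta> \<le> (r + d x0 x) powr \<delta>"
        using k(1) r \<delta>(1) by (intro powr_mono2) auto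
      moreover have "b k \<le> Lphi_norm \<mu> \<phi> (indicator (qball d x0 (r + d x0 x)))"
        unfolding b_def by (intro Lphi_norm_mono qball_mono k)
      ultimately have "ennreal ((2 ^ k * r) powr \<delta>) * b k \<le> ennreal ((r + d x0 x) powr \<delta>) *
        Lphi_norm \<mu> \<phi> (indicator (qball d x0 (r + d x0 x)))"
        by (intro mult_mono ennreal_leI) auto
      then have "h x / (ennreal ((r + d x0 x) powr \<delta>) *
        Lphi_norm \<mu> \<phi> (indicator (qball d x0 (r + d x0 x)))) \<le> h x * c k"
        unfolding divide_ennreal_def c_def by (intro mult_left_mono ennreal_inverse_antimono) auto
      also have "\<dots> = c k * (h x * indicator (B k) x)" using \<open>x \<in> B k\<close> by (simp add: mult.commute)
      also have "\<dots> \<le> (\<Sum>k. c k * (h x * indicator (B k) x))"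
        using sum_le_suminf[of "\<lambda>k. c k * (h x * indicator (B k) x)" "{k}"] by simp
      finally show "h x / (ennreal ((r + d x0 x) powr \<delta>) *
        Lphi_norm \<mu> \<phi> (indicator (qball d x0 (r + d x0 x)))) \<le> (\<Sum>k. c k * (h x * indicator (B k) x))" .
    qed
    also have "\<dots> = (\<Sum>k. c k * (\<integral>\<^sup>+x\<in>B k. h x \<partial>\<mu>))"
      by (simp add: nn_integral_suminf nn_integral_cmult)
    also have "\<dots> \<le> (\<Sum>k. ennreal (C / r powr \<delta> * \<rho> ^ k) * N)"
    proof (intro suminf_le)
      fix k
      have two: "(2::real) ^ k = 2 powr real k" by (simp add: powr_realpow)
      have "r \<le> 2 ^ k * r" using r mult_right_mono[of 1 "2 ^ k" r] by simp
      then have "(\<integral>\<^sup>+x\<in>B k. h x \<partial>\<mu>) \<le> ennreal (C * (2 ^ k * r / r) powr \<gamma>) * N * b k"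
        unfolding B_def b_def \<gamma>_def by (intro C(2) r h hN)
      then have "c k * (\<integral>\<^sup>+x\<in>B k. h x \<partial>\<mu>) \<le> c k * (ennreal (C * (2 ^ k * r / r) powr \<gamma>) * N * b k)"
        by (rule mult_left_mono) simp
      also have "\<dots> = c k * b k * (ennreal (C * (2 ^ k * r / r) powr \<gamma>) * N)" by (simp add: mult_ac)
      also have "\<dots> \<le> ennreal (1 / (2 ^ k * r) powr \<delta>) * (ennreal (C * (2 ^ k * r / r) powr \<gamma>) * N)"
        unfolding c_def using r by (intro mult_right_mono ennreal_inverse_mult_cancel_le) auto
      also have "\<dots> = ennreal (1 / (2 ^ k * r) powr \<delta> * (C * (2 ^ k * r / r) powr \<gamma>)) * N"
      proof -
        have "ennreal (1 / (2 ^ k * r) powr \<delta> * (C * (2 ^ k * r / r) powr \<gamma>)) =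
          ennreal (1 / (2 ^ k * r) powr \<delta>) * ennreal (C * (2 ^ k * r / r) powr \<gamma>)"
          using C(1) by (intro ennreal_mult) auto
        then show ?thesis by (simp only: mult.assoc[where 'a = ennreal])
      qed
      also have "1 / (2 ^ k * r) powr \<delta> * (C * (2 ^ k * r / r) powr \<gamma>) =
        C / r powr \<delta> * ((2 ^ k) powr \<gamma> / (2 ^ k) powr \<delta>)"
        using r by (simp add: powr_mult)
      also have "(2 ^ k) powr \<gamma> / (2 ^ k) powr \<delta> = ((2::real) ^ k) powr (\<gamma> - \<delta>)"
        by (simp add: powr_diff)
      also have "\<dots> = \<rho> ^ k"
      proof -
        have "((2::real) ^ k) powr (\<gamma> - \<delta>) = (2 powr (\<gamma> - \<delta>)) powr real k"
          unfolding two powr_powr by (simp only: mult.commute)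
        also have "\<dots> = \<rho> ^ k" unfolding \<rho>_def by (rule powr_realpow) simp
        finally show ?thesis .
      qed
      finally show "c k * (\<integral>\<^sup>+x\<in>B k. h x \<partial>\<mu>) \<le> ennreal (C / r powr \<delta> * \<rho> ^ k) * N" .
    qed auto
    also have "\<dots> = (\<Sum>k. ennreal (C / r powr \<delta> * \<rho> ^ k)) * N" by simp
    also have "(\<Sum>k. ennreal (C / r powr \<delta> * \<rho> ^ k)) = ennreal (\<Sum>k. C / r powr \<delta> * \<rho> ^ k)"
      using C(1) \<rho> by (intro suminf_ennreal2 summable_mult summable_geometric) auto
    \<comment> \<open>The geometric sum supplies the final constant, and
      \<open>r powr \<delta>\<close> is \<open>t powr (\<delta> / m)\<close>.\<close>
    also have "(\<Sum>k. C / r powr \<delta> * \<rho> ^ k) = C / r powr \<delta> * (1 / (1 - \<rho>))"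
      using \<rho> by (subst suminf_mult) (auto simp: suminf_geometric summable_geometric)
    also have "\<dots> = C / (1 - \<rho>) / t powr (\<delta> / m)"
      by (simp add: r_def powr_powr)
    finally show "(\<integral>\<^sup>+x. ennreal (cmod (f x - A_op \<mu> a t f x)) /
               (ennreal ((t powr (1 / m) + d x0 x) powr \<delta>) *
                Lphi_norm \<mu> \<phi> (indicator (qball d x0 (t powr (1 / m) + d x0 x)))) \<partial>\<mu>)
           \<le> ennreal (C / (1 - \<rho>) / t powr (\<delta> / m)) * BMO_norm d \<mu> \<phi> m a f"
      unfolding h_def N_def r_def .
  qed
qed

end
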